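(* Let $\mathbb{K}$ be an algebraically closed field, $V$ a $\mathbb{K}$-vector space of finite positive dimension, and $\Phi=(A;\{E_i\}_{i=0}^d;A^*;\{E_i^*\}_{i=0}^d)$ a TD system on $V$ of diameter $d\geq 1$ that has $q$-Racah type, with fixed associated scalars $q,a,b$. Let $K,B,\psi,\mathcal{M}$ be the associated elements of $\mathrm{End}(V)$ defined in the context. Then both $$K \exp_q\left(\frac{a^{-1}}{q-q^{-1}}\psi\right)=\exp_q\left(\frac{a^{-1}}{q-q^{-1}}\psi\right) \mathcal{M},$$ $$B \exp_q\left(\frac{a}{q-q^{-1}}\psi\right)=\exp_q\left(\frac{a}{q-q^{-1}}\psi\right) \mathcal{M}.$$
   Context: TD pair: an ordered pair of linear maps $A,A^*:V\to V$ such that (i) each is diagonalizable; (ii) there is an ordering $\{V_i\}_{i=0}^d$ of the eigenspaces of $A$ with $A^*V_i\subseteq V_{i-1}+V_i+V_{i+1}$ for $0\le i\le d$ ($V_{-1}=V_{d+1}=0$); (iii) there is an ordering $\{V_i^*\}_{i=0}^\delta$ of the eigenspaces of $A^*$ with $AV_i^*\subseteq V_{i-1}^*+V_i^*+V_{i+1}^*$ for $0\le i\le\delta$ ($V^*_{-1}=V^*_{\delta+1}=0$); (iv) no subspace $W$ with $0\ne W\ne V$ satisfies $AW\subseteq W$ and $A^*W\subseteq W$. It is known that $d=\delta$; $d$ is called the diameter. Orderings as in (ii), (iii) are called standard. The primitive idempotent of $A$ for an eigenspace $V_i$ is the projection of $V$ onto $V_i$ that vanishes on the other eigenspaces (similarly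 for $A^*$). TD system: $(A;\{E_i\}_{i=0}^d;A^*;\{E_i^*\}_{i=0}^d)$ where $A,A^*$ is a TD pair and $\{E_i\}$, $\{E_i^*\}$ are the primitive idempotents of $A$, $A^*$, in orders for which the corresponding eigenspace orderings $\{E_iV\}$, $\{E_i^*V\}$ are standard. Let $\theta_i$ (resp. $\theta_i^*$) be the eigenvalue of $A$ on $E_iV$ (resp. of $A^*$ on $E_i^*V$). $\Phi$ has $q$-Racah type if there are nonzero $q,a,b\in\mathbb{K}$ with $q^4\ne1$ and $\theta_i=aq^{d-2i}+a^{-1}q^{2i-d}$, $\theta_i^*=bq^{d-2i}+b^{-1}q^{2i-d}$ for $0\le i\le d$. (Distinctness of eigenvalues forces $q^{2i}\neq1$ for $1\le i\le d$, and $a^2\ne q^{2d-2},q^{2d-4},\dots,q^{2-2d}$; in particular $a^2\neq 1$.) Split decompositions: $U_i=(E_0^*V+\cdots+E_i^*V)\cap(E_iV+\cdots+E_dV)$ and $U_i^\Downarrow=(E_0^*V+\cdots+E_i^*V)\cap(E_0V+\cdots+E_{d-i}V)$ for $0\le i\le d$. It is known that $V=\bigoplus_i U_i=\bigoplus_i U_i^\Downarrow$ with all summands nonzero. $K,B\in\mathrm{End}(V)$ are the linear maps acting on $U_i$, respectively $U_i^\Downarrow$, as the scalar $q^{d-2i}$ ($0\le i\le d$). $\psi\in\mathrm{End}(V)$: $\psi=(I-BK^{-1})\,\bigl(q(aI-a^{-1}BK^{-1})\bigr)^{-1}$ (the inverse is known to exist; it is known that $\psi$ also equals $q(I-K^{-1}B)(aI-a^{-1}K^{-1}B)^{-1}$,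 $(I-KB^{-1})(q(a^{-1}I-aKB^{-1}))^{-1}$ and $q(I-B^{-1}K)(a^{-1}I-aB^{-1}K)^{-1}$). It is known that $\psi^{d+1}=0$. $\mathcal{M}\in\mathrm{End}(V)$: $\mathcal{M}=\dfrac{aK-a^{-1}B}{a-a^{-1}}$. $q$-exponential: $[n]_q=\frac{q^n-q^{-n}}{q-q^{-1}}$, $[n]_q^!=[n]_q[n-1]_q\cdots[1]_q$, $[0]_q^!=1$; for nilpotent $T$, $\exp_q(T)=\sum_{n\ge0}\frac{q^{\binom n2}}{[n]_q^!}T^n$. For $T$ a scalar multiple of $\psi$ the sum runs over $0\le n\le d$, since $\psi^{d+1}=0$. *)

theory Defs
  imports
    "HOL-Computational_Algebra.Polynomial"
    "HOL-Library.Set_Algebras"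
begin

text \<open>
  The vector space \<open>V\<close> is the whole type \<open>'v\<close>, with scalar multiplication \<open>s\<close>; the definitions are
  meant for \<open>s\<close> satisfying \<^locale>\<open>vector_space\<close>. Sums of subspaces are the elementwise sums of sets
  from \<^theory>\<open>HOL-Library.Set_Algebras\<close>, so that \<open>E\<^sub>iV + \<dots> + E\<^sub>dV\<close> is \<open>\<Sum>j=i..d. range (E j)\<close>.
\<close>

type_synonym ('k, 'v) scaling = "'k \<Rightarrow> 'v \<Rightarrow> 'v"

definition eigenspace ::
  "('k::field, 'v::ab_group_add) scaling \<Rightarrow> ('v \<Rightarrow> 'v) \<Rightarrow> 'k \<Rightarrow> 'v set"
  where "eigenspace s A t = {v. A v = s t v}"

definition eigenspaces ::
  "('k::field, 'v::ab_group_add) scaling \<Rightarrow> ('v \<Rightarrow> 'v) \<Rightarrow> 'v set set"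
  where "eigenspaces s A = {W. W \<noteq> {0} \<and> (\<exists>t. W = eigenspace s A t)}"

definition diagonalizable ::
  "('k::field, 'v::ab_group_add) scaling \<Rightarrow> ('v \<Rightarrow> 'v) \<Rightarrow> bool"
  where "diagonalizable s A \<longleftrightarrow> module.span s (\<Union>(eigenspaces s A)) = UNIV"

text \<open>\<open>standard_ordering s A B d W\<close>: the sequence \<open>W 0, \<dots>, W d\<close> lists the eigenspaces of \<open>A\<close>, without
  repetition, and \<open>B\<close> acts on it in block-tridiagonal fashion.\<close>

definition standard_ordering ::
  "('k::field, 'v::ab_group_add) scaling \<Rightarrow> ('v \<Rightarrow> 'v) \<Rightarrow> ('v \<Rightarrow> 'v) \<Rightarrow> nat
    \<Rightarrow> (nat \<Rightarrow> 'v set) \<Rightarrow> bool"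
  where "standard_ordering s A B d W \<longleftrightarrow>
    bij_betw W {0..d} (eigenspaces s A) \<and>
    (\<forall>i\<le>d. B ` W i \<subseteq>
       (if i = 0 then {0} else W (i - 1)) + W i + (if i = d then {0} else W (i + 1)))"

definition TD_pair ::
  "('k::field, 'v::ab_group_add) scaling \<Rightarrow> ('v \<Rightarrow> 'v) \<Rightarrow> ('v \<Rightarrow> 'v) \<Rightarrow> bool"
  where "TD_pair s A As \<longleftrightarrow>
    Vector_Spaces.linear s s A \<and> Vector_Spaces.linear s s As \<and>
    diagonalizable s A \<and> diagonalizable s As \<and>
    (\<exists>d W. standard_ordering s A As d W) \<and>
    (\<exists>\<delta> Ws. standard_ordering s As A \<delta> Ws) \<and>
    \<not> (\<exists>W. module.subspace s W \<and> W \<noteq> {0} \<and> W \<noteq> UNIV \<and> A ` W \<subseteq> W \<and> As ` W \<subseteq> W)"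

definition primitive_idempotent ::
  "('k::field, 'v::ab_group_add) scaling \<Rightarrow> ('v \<Rightarrow> 'v) \<Rightarrow> 'v set \<Rightarrow> ('v \<Rightarrow> 'v) \<Rightarrow> bool"
  where "primitive_idempotent s A W P \<longleftrightarrow>
    W \<in> eigenspaces s A \<and> Vector_Spaces.linear s s P \<and> range P = W \<and> (\<forall>v\<in>W. P v = v) \<and>
    (\<forall>W'\<in>eigenspaces s A. W' \<noteq> W \<longrightarrow> (\<forall>v\<in>W'. P v = 0))"

definition TD_system ::
  "('k::field, 'v::ab_group_add) scaling \<Rightarrow> nat \<Rightarrow> ('v \<Rightarrow> 'v) \<Rightarrow> (nat \<Rightarrow> 'v \<Rightarrow> 'v)
    \<Rightarrow> ('v \<Rightarrow> 'v) \<Rightarrow> (nat \<Rightarrow> 'v \<Rightarrow> 'v) \<Rightarrow> bool"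
  where "TD_system s d A E As Es \<longleftrightarrow>
    TD_pair s A As \<and>
    (\<forall>i\<le>d. primitive_idempotent s A (range (E i)) (E i)) \<and>
    (\<forall>i\<le>d. primitive_idempotent s As (range (Es i)) (Es i)) \<and>
    standard_ordering s A As d (\<lambda>i. range (E i)) \<and>
    standard_ordering s As A d (\<lambda>i. range (Es i))"

text \<open>Since \<open>range (E i)\<close> is an eigenspace and hence nonzero, the equation
  \<open>range (E i) = eigenspace s A t\<close> says that \<open>t\<close> is the eigenvalue of \<open>A\<close> on it.\<close>

definition q_Racah_type ::
  "('k::field, 'v::ab_group_add) scaling \<Rightarrow> nat \<Rightarrow> ('v \<Rightarrow> 'v) \<Rightarrow> (nat \<Rightarrow> 'v \<Rightarrow> 'v)
    \<Rightarrow> ('v \<Rightarrow> 'v) \<Rightarrow> (nat \<Rightarrow> 'v \<Rightarrow> 'v) \<Rightarrow> 'k \<Rightarrow> 'k \<Rightarrow> 'k \<Rightarrow> bool"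
  where "q_Racah_type s d A E As Es q a b \<longleftrightarrow>
    q \<noteq> 0 \<and> a \<noteq> 0 \<and> b \<noteq> 0 \<and> q ^ 4 \<noteq> 1 \<and>
    (\<forall>i\<le>d. range (E i) = eigenspace s A
       (a * q powi (int d - 2 * int i) + inverse a * q powi (2 * int i - int d))) \<and>
    (\<forall>i\<le>d. range (Es i) = eigenspace s As
       (b * q powi (int d - 2 * int i) + inverse b * q powi (2 * int i - int d)))"

definition split_decomp ::
  "nat \<Rightarrow> (nat \<Rightarrow> 'v \<Rightarrow> 'v) \<Rightarrow> (nat \<Rightarrow> 'v \<Rightarrow> 'v) \<Rightarrow> nat \<Rightarrow> 'v::ab_group_add set"
  where "split_decomp d E Es i = (\<Sum>j=0..i. range (Es j)) \<inter> (\<Sum>j=i..d. range (E j))"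

definition split_decomp_down ::
  "nat \<Rightarrow> (nat \<Rightarrow> 'v \<Rightarrow> 'v) \<Rightarrow> (nat \<Rightarrow> 'v \<Rightarrow> 'v) \<Rightarrow> nat \<Rightarrow> 'v::ab_group_add set"
  where "split_decomp_down d E Es i = (\<Sum>j=0..i. range (Es j)) \<inter> (\<Sum>j=0..d-i. range (E j))"

text \<open>The description is proper whenever \<open>V\<close> is the direct sum of \<open>U 0, \<dots>, U d\<close>.\<close>

definition split_operator ::
  "('k::field, 'v::ab_group_add) scaling \<Rightarrow> nat \<Rightarrow> 'k \<Rightarrow> (nat \<Rightarrow> 'v set) \<Rightarrow> 'v \<Rightarrow> 'v"
  where "split_operator s d q U =
    (THE T. Vector_Spaces.linear s s T \<and>
            (\<forall>i\<le>d. \<forall>u\<in>U i. T u = s (q powi (int d - 2 * int i)) u))"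

definition K_op ::
  "('k::field, 'v::ab_group_add) scaling \<Rightarrow> nat \<Rightarrow> (nat \<Rightarrow> 'v \<Rightarrow> 'v) \<Rightarrow> (nat \<Rightarrow> 'v \<Rightarrow> 'v)
    \<Rightarrow> 'k \<Rightarrow> 'v \<Rightarrow> 'v"
  where "K_op s d E Es q = split_operator s d q (split_decomp d E Es)"

definition B_op ::
  "('k::field, 'v::ab_group_add) scaling \<Rightarrow> nat \<Rightarrow> (nat \<Rightarrow> 'v \<Rightarrow> 'v) \<Rightarrow> (nat \<Rightarrow> 'v \<Rightarrow> 'v)
    \<Rightarrow> 'k \<Rightarrow> 'v \<Rightarrow> 'v"
  where "B_op s d E Es q = split_operator s d q (split_decomp_down d E Es)"

definition psi_op ::
  "('k::field, 'v::ab_group_add) scaling \<Rightarrow> 'k \<Rightarrow> 'k \<Rightarrow> ('v \<Rightarrow> 'v) \<Rightarrow> ('v \<Rightarrow> 'v) \<Rightarrow> 'v \<Rightarrow> 'v"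
  where "psi_op s q a K B =
    (\<lambda>v. v - B (inv K v)) \<circ> inv (\<lambda>v. s q (s a v - s (inverse a) (B (inv K v))))"

definition M_op ::
  "('k::field, 'v::ab_group_add) scaling \<Rightarrow> 'k \<Rightarrow> ('v \<Rightarrow> 'v) \<Rightarrow> ('v \<Rightarrow> 'v) \<Rightarrow> 'v \<Rightarrow> 'v"
  where "M_op s a K B =
    (\<lambda>v. s (inverse (a - inverse a)) (s a (K v) - s (inverse a) (B v)))"

definition q_int :: "'k::field \<Rightarrow> nat \<Rightarrow> 'k"
  where "q_int q n = (q ^ n - inverse q ^ n) / (q - inverse q)"

definition q_fact :: "'k::field \<Rightarrow> nat \<Rightarrow> 'k"
  where "q_fact q n = (\<Prod>k=1..n. q_int q k)"

text \<open>For nilpotent \<open>T\<close> the index set is finite and the omitted terms all vanish.\<close>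

definition q_exp ::
  "('k::field, 'v::ab_group_add) scaling \<Rightarrow> 'k \<Rightarrow> ('v \<Rightarrow> 'v) \<Rightarrow> 'v \<Rightarrow> 'v"
  where "q_exp s q T = (\<lambda>v. \<Sum>n | T ^^ n \<noteq> (\<lambda>_. 0).
    s (q ^ (n choose 2) / q_fact q n) ((T ^^ n) v))"

end

theory Submission
  imports Defs
begin

text \<open>
  Both \<open>K\<close> and \<open>B\<close> satisfy a quadratic \<open>q\<close>-commutation relation with each of \<open>A\<close> and \<open>A\<^sup>*\<close>, read off from
  the way \<open>A\<close> raises and \<open>A\<^sup>*\<close> lowers the split decompositions; the relations for \<open>B\<close> arise from those
  for \<open>K\<close> by reversing the order of the \<open>E\<^sub>i\<close> and replacing \<open>a\<close> by its inverse. Let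
  \<open>Z = q\<^sup>2 (K - B) (a\<^sup>2 K - B) - (a\<^sup>2 K - B) (K - B)\<close>. Modulo \<open>K Z\<close>, \<open>Z K\<close>, \<open>B Z\<close>, \<open>Z B\<close>, the
  element \<open>Z\<close> commutes with \<open>A\<close> and \<open>A\<^sup>*\<close> up to nonzero scalars. Hence the largest subspace of the kernel
  of \<open>Z\<close> invariant under \<open>K\<close> and \<open>B\<close> is invariant under \<open>A\<close> and \<open>A\<^sup>*\<close>. It contains \<open>E\<^sub>0\<^sup>* V\<close>, where \<open>K\<close>
  and \<open>B\<close> act as the same scalar, so it is \<open>V\<close> by irreducibility, and \<open>Z = 0\<close>. As \<open>\<psi> M\<close> is a multiple of
  \<open>K - B\<close> and \<open>M\<close> a multiple of \<open>a\<^sup>2 K - B\<close>, this says \<open>M \<psi> = q\<^sup>2 \<psi> M\<close>. Together with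
  \<open>K = (I - q a\<^sup>-\<^sup>1 \<psi>) M\<close>, \<open>B = (I - q a \<psi>) M\<close> and the functional equation
  \<open>(I - (q\<^sup>2 - 1) T) exp\<^sub>q (q\<^sup>2 T) = exp\<^sub>q T\<close> it gives the claim.
\<close>

section \<open>Endomorphisms of a vector space\<close>

locale endomorphisms = vector_space scale
  for scale :: "'k::field \<Rightarrow> 'v::ab_group_add \<Rightarrow> 'v"
begin

abbreviation endo :: "('v \<Rightarrow> 'v) \<Rightarrow> bool"
  where "endo \<equiv> Vector_Spaces.linear scale scale"

lemma endo_simps:
  fixes f :: "'v \<Rightarrow> 'v"
  assumes "endo f"
  shows "f (x + y) = f x + f y" "f (x - y) = f x - f y" "f (scale c x) = scale c (f x)"
    "f 0 = 0" "f (- x) = - f x" "f (sum g I) = (\<Sum>i\<in>I. f (g i))"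
  using assms module_hom.add[of scale scale f] module_hom.diff[of scale scale f]
    module_hom.scale[of scale scale f] module_hom.zero[of scale scale f]
    module_hom.neg[of scale scale f] module_hom.sum[of scale scale f]
  by (simp_all add: Vector_Spaces.linear_def)

lemma endoI:
  fixes f :: "'v \<Rightarrow> 'v"
  assumes "\<And>x y. f (x + y) = f x + f y" "\<And>c x. f (scale c x) = scale c (f x)"
  shows "endo f"
  using assms vector_space_axioms
  by (simp add: Vector_Spaces.linear_def module_hom_def module_hom_axioms_def
      module_iff_vector_space)

lemma endo_eq_on_span_UNIV:
  assumes "endo f" "endo g"
    and "\<And>v. v \<in> S \<Longrightarrow> f v = g v" "span S = UNIV"
  shows "f v = g v"
proof -
  have "v \<in> span S" using assms(4) by simp
  then show ?thesis
    by (induction rule: span_induct_alt)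
      (simp_all add: assms(3) endo_simps[OF assms(1)] endo_simps[OF assms(2)])
qed

text \<open>Components \<open>P v i\<close> are obtained by choice. Independence makes them unique,
  so \<open>S\<close>, the sum of the scaled components, is linear; spanning makes \<open>S\<close>
  the only linear map with the prescribed action, and the \<open>THE\<close> in
  \<open>split_operator\<close> is proper.\<close>

lemma split_operator_direct_sum:
  fixes d :: nat and q :: 'k
  assumes sub: "\<And>i. i \<le> d \<Longrightarrow> subspace (U i)"
    and spanning: "span (\<Union>i\<le>d. U i) = UNIV"
    and indep: "\<And>f. (\<And>i. i \<le> d \<Longrightarrow> f i \<in> U i) \<Longrightarrow> (\<Sum>i\<le>d. f i) = 0 \<Longrightarrow> \<forall>i\<le>d. f i = 0"
  defines "T \<equiv> split_operator scale d q U"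
  shows "endo T"
    and "\<And>i u. i \<le> d \<Longrightarrow> u \<in> U i \<Longrightarrow> T u = scale (q powi (int d - 2 * int i)) u"
    and "\<And>v. \<exists>f. (\<forall>i\<le>d. f i \<in> U i) \<and> v = (\<Sum>i\<le>d. f i)"
proof -
  define x where "x = (\<lambda>i. q powi (int d - 2 * int i))"
  have ex: "\<exists>f. (\<forall>i\<le>d. f i \<in> U i) \<and> v = (\<Sum>i\<le>d. f i)" for v
  proof -
    have "v \<in> span (\<Union>i\<le>d. U i)" using spanning by simp
    then show ?thesis
    proof (induction rule: span_induct_alt)
      case base
      show ?case by (rule exI[of _ "\<lambda>_. 0"]) (simp add: sub subspace_0)
    next
      case (step c y z)
      then obtain f where f: "\<forall>i\<le>d. f i \<in> U i" "z = (\<Sum>i\<le>d. f i)" by blast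
      obtain k where k: "k \<le> d" "y \<in> U k" using step by blast
      show ?case
        by (rule exI[of _ "f(k := scale c y + f k)"])
          (use f k in \<open>auto simp: sub subspace_add subspace_scale sum.remove[where x=k]\<close>)
    qed
  qed
  then obtain P where P: "\<And>v i. i \<le> d \<Longrightarrow> P v i \<in> U i" "\<And>v. v = (\<Sum>i\<le>d. P v i)"
    by metis
  have unique: "f i = P v i" if "\<And>i. i \<le> d \<Longrightarrow> f i \<in> U i" "(\<Sum>i\<le>d. f i) = v" "i \<le> d" for f v i
  proof -
    have "\<forall>i\<le>d. f i - P v i = 0"
      by (rule indep) (use that P in \<open>simp_all add: sub subspace_diff sum_subtractf flip: P(2)\<close>)
    then show ?thesis using that by simp
  qed
  define S where "S = (\<lambda>v. \<Sum>i\<le>d. scale (x i) (P v i))"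
  have "P (v + w) i = P v i + P w i" if "i \<le> d" for v w i
    using that by (intro unique[where f="\<lambda>i. P v i + P w i", symmetric])
      (simp_all add: P sub subspace_add sum.distrib flip: P(2))
  then have S_add: "S (v + w) = S v + S w" for v w
    by (simp add: S_def scale_right_distrib sum.distrib)
  have "P (scale c v) i = scale c (P v i)" if "i \<le> d" for c v i
    using that by (intro unique[where f="\<lambda>i. scale c (P v i)", symmetric])
      (simp_all add: P sub subspace_scale flip: P(2) scale_sum_right)
  then have "S (scale c v) = scale c (S v)" for c v
    by (simp add: S_def scale_sum_right mult.commute)
  with S_add have S: "endo S" by (rule endoI)
  have Su: "S u = scale (x i) u" if "i \<le> d" "u \<in> U i" for i u
  proof -
    have "(if j = i then u else 0) = P u j" if "j \<le> d" for j
      using \<open>i \<le> d\<close> \<open>u \<in> U i\<close> that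
      by (intro unique[where f="\<lambda>j. if j = i then u else 0"]) (auto simp: sub subspace_0)
    then have "S u = (\<Sum>j\<le>d. scale (x j) (if j = i then u else 0))"
      unfolding S_def by (intro sum.cong) auto
    also have "\<dots> = scale (x i) u"
      using that by (subst sum.remove[where x=i]) auto
    finally show ?thesis .
  qed
  have "T = S"
    unfolding T_def split_operator_def
  proof (rule the_equality)
    show "endo S \<and>
      (\<forall>i\<le>d. \<forall>u\<in>U i. S u = scale (q powi (int d - 2 * int i)) u)"
      using S Su by (simp add: x_def)
  next
    fix T' assume T': "endo T' \<and>
      (\<forall>i\<le>d. \<forall>u\<in>U i. T' u = scale (q powi (int d - 2 * int i)) u)"
    show "T' = S"
      by (rule ext, rule endo_eq_on_span_UNIV[OF _ S _ spanning])
        (use T' Su in \<open>auto simp: x_def\<close>)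
  qed
  then show "endo T"
    and "\<And>i u. i \<le> d \<Longrightarrow> u \<in> U i \<Longrightarrow> T u = scale (q powi (int d - 2 * int i)) u"
    using S Su by (simp_all add: x_def)
  show "\<And>v. \<exists>f. (\<forall>i\<le>d. f i \<in> U i) \<and> v = (\<Sum>i\<le>d. f i)" by (rule ex)
qed

section \<open>The \<open>q\<close>-commutation defect\<close>

text \<open>\<open>C\<close> is moved left past one letter at a time, each letter using one factor
  \<open>p\<close>. With \<open>K\<close> and \<open>L\<close> each standing for either operator,
  this covers all four quadratic words of \<open>q_defect\<close>.\<close>

lemma commute_past_word:
  assumes "endo K" "endo L" "endo C"
    and "\<And>v. scale p (K (C v)) = C (K v) + scale e (K (K v)) + scale f v"
    and "\<And>v. scale p (L (C v)) = C (L v) + scale e' (L (L v)) + scale f' v"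
  shows "scale (p * p) (K (L (C v))) = C (K (L v)) + scale e (K (K (L v))) + scale f (L v)
    + scale p (scale e' (K (L (L v))) + scale f' (K v))"
proof -
  have "scale (p * p) (K (L (C v))) = scale p (K (scale p (L (C v))))"
    by (simp add: endo_simps[OF assms(1)])
  also have "\<dots> = scale p (K (C (L v))) + scale p (scale e' (K (L (L v))) + scale f' (K v))"
    by (simp add: assms(5) endo_simps[OF assms(1)] scale_right_distrib)
  finally show ?thesis by (simp add: assms(4))
qed

lemma commute_past_word_dual:
  assumes "endo K" "endo L" "endo C"
    and "\<And>v. scale p (C (K v)) = K (C v) + scale e (K (K v)) + scale f v"
    and "\<And>v. scale p (C (L v)) = L (C v) + scale e' (L (L v)) + scale f' v"
  shows "scale (p * p) (C (K (L v))) = K (L (C v)) + scale e' (K (L (L v))) + scale f' (K v)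
    + scale p (scale e (K (K (L v))) + scale f (L v))"
proof -
  have "scale (p * p) (C (K (L v))) = scale p (scale p (C (K (L v))))" by simp
  also have "\<dots> = K (scale p (C (L v))) + scale p (scale e (K (K (L v))) + scale f (L v))"
    by (simp add: assms(4) endo_simps[OF assms(1)] scale_right_distrib)
  also have "\<dots> = K (L (C v)) + scale e' (K (L (L v))) + scale f' (K v)
    + scale p (scale e (K (K (L v))) + scale f (L v))"
    by (simp add: assms(5) endo_simps[OF assms(1)])
  finally show ?thesis .
qed

text \<open>The expansion of \<open>p (K - B) (c K - B) - (c K - B) (K - B)\<close>.\<close>

definition q_defect :: "'k \<Rightarrow> 'k \<Rightarrow> ('v \<Rightarrow> 'v) \<Rightarrow> ('v \<Rightarrow> 'v) \<Rightarrow> 'v \<Rightarrow> 'v"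
  where "q_defect p c K B v = scale (c * (p - 1)) (K (K v)) - scale (p - c) (K (B v))
    - scale (c * p - 1) (B (K v)) + scale (p - 1) (B (B v))"

lemma endo_q_defect: "endo K \<Longrightarrow> endo B \<Longrightarrow> endo (q_defect p c K B)"
  by (rule endoI)
    (simp_all add: q_defect_def endo_simps scale_right_distrib scale_right_diff_distrib mult.commute)

text \<open>Moving \<open>C\<close> through the four words of \<open>Z\<close> leaves linear and
  cubic remainders. The linear ones cancel; the cubic ones, multiplied by \<open>1 - c\<close> to
  clear denominators, combine into \<open>K Z\<close>, \<open>Z K\<close>, \<open>B Z\<close> and
  \<open>Z B\<close>.\<close>

lemma q_defect_commute_A:
  fixes p c :: 'k
  assumes KB: "endo K" "endo B" and C: "endo C"
    and KC: "\<And>v. scale p (K (C v)) = C (K v) + scale c (K (K v)) + scale 1 v"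
    and BC: "\<And>v. scale p (B (C v)) = C (B v) + scale 1 (B (B v)) + scale c v"
  defines "Z \<equiv> q_defect p c K B"
  shows "scale ((1 - c) * (p * p)) (Z (C v)) = scale (1 - c) (C (Z v))
    + scale (c * (p - c)) (K (Z v)) - scale (c * (c * p - 1)) (Z (K v))
    - scale (c * p - 1) (B (Z v)) + scale (p - c) (Z (B v))"
proof -
  have "scale ((1 - c) * (p * p)) (Z (C v)) = scale (1 - c) (
      scale (c * (p - 1)) (scale (p * p) (K (K (C v)))) - scale (p - c) (scale (p * p) (K (B (C v))))
    - scale (c * p - 1) (scale (p * p) (B (K (C v)))) + scale (p - 1) (scale (p * p) (B (B (C v)))))"
    by (simp add: Z_def q_defect_def scale_right_distrib scale_right_diff_distrib mult_ac)
  then show ?thesis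
    by (simp only: commute_past_word[OF KB(1) KB(1) C KC KC] commute_past_word[OF KB(1) KB(2) C KC BC]
        commute_past_word[OF KB(2) KB(1) C BC KC] commute_past_word[OF KB(2) KB(2) C BC BC])
      (simp add: Z_def q_defect_def endo_simps[OF KB(1)] endo_simps[OF KB(2)] endo_simps[OF C]
        algebra_simps)
qed

text \<open>The same cancellation with \<open>C\<close> moved to the right; here \<open>K\<close>
  and \<open>B\<close> obey relations with equal coefficients.\<close>

lemma q_defect_commute_As:
  fixes p c e :: 'k
  assumes KB: "endo K" "endo B" and C: "endo C"
    and KC: "\<And>v. scale p (C (K v)) = K (C v) + scale e (K (K v)) + scale 1 v"
    and BC: "\<And>v. scale p (C (B v)) = B (C v) + scale e (B (B v)) + scale 1 v"
  defines "Z \<equiv> q_defect p c K B"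
  shows "scale ((1 - c) * (p * p)) (C (Z v)) = scale (1 - c) (Z (C v))
    + scale (e * (p - c)) (K (Z v)) - scale (e * (c * p - 1)) (Z (K v))
    - scale (e * (c * p - 1)) (B (Z v)) + scale (e * (p - c)) (Z (B v))"
proof -
  have "scale ((1 - c) * (p * p)) (C (Z v)) = scale (1 - c) (
      scale (c * (p - 1)) (scale (p * p) (C (K (K v)))) - scale (p - c) (scale (p * p) (C (K (B v))))
    - scale (c * p - 1) (scale (p * p) (C (B (K v)))) + scale (p - 1) (scale (p * p) (C (B (B v)))))"
    by (simp add: Z_def q_defect_def endo_simps[OF C] scale_right_distrib scale_right_diff_distrib mult_ac)
  then show ?thesis
    by (simp only: commute_past_word_dual[OF KB(1) KB(1) C KC KC]
        commute_past_word_dual[OF KB(1) KB(2) C KC BC]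
        commute_past_word_dual[OF KB(2) KB(1) C BC KC] commute_past_word_dual[OF KB(2) KB(2) C BC BC])
      (simp add: Z_def q_defect_def endo_simps[OF KB(1)] endo_simps[OF KB(2)] endo_simps[OF C]
        algebra_simps)
qed

text \<open>For linear maps, the largest subspace of the kernel of \<open>Z\<close> stable under
  \<open>K\<close> and \<open>B\<close>. Boolean lists encode words in \<open>K\<close> and
  \<open>B\<close>, the head acting first, so stability amounts to prefixing a letter.\<close>

definition invariant_core :: "('v \<Rightarrow> 'v) \<Rightarrow> ('v \<Rightarrow> 'v) \<Rightarrow> ('v \<Rightarrow> 'v) \<Rightarrow> 'v set"
  where "invariant_core Z K B = {v. \<forall>w. Z (fold (\<lambda>b. if b then K else B) w v) = 0}"

lemma invariant_core_D: "v \<in> invariant_core Z K B \<Longrightarrow> Z v = 0"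
  unfolding invariant_core_def by (drule CollectD, drule spec[of _ "[]"]) simp

lemma invariant_core_K: "v \<in> invariant_core Z K B \<Longrightarrow> K v \<in> invariant_core Z K B"
  unfolding invariant_core_def by (clarify, drule spec[of _ "True # _"]) simp

lemma invariant_core_B: "v \<in> invariant_core Z K B \<Longrightarrow> B v \<in> invariant_core Z K B"
  unfolding invariant_core_def by (clarify, drule spec[of _ "False # _"]) simp

lemma endo_fold:
  assumes "endo K" "endo B"
  shows "endo (fold (\<lambda>b. if b then K else B) w)"
proof (induction w)
  case Nil
  show ?case by (rule endoI) simp_all
next
  case (Cons b w)
  then show ?case using assms by (intro endoI) (auto simp: endo_simps)
qed

lemma subspace_invariant_core:
  assumes "endo Z" "endo K" "endo B"
  shows "subspace (invariant_core Z K B)"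
  by (auto simp: invariant_core_def subspace_def endo_simps[OF assms(1)] endo_simps[OF endo_fold[OF assms(2,3)]])

text \<open>Induction on the word: modulo the core, \<open>C\<close> is exchanged with a letter at
  the cost of the scalar \<open>r\<close>, and the letter takes \<open>v\<close> to another element
  of the core, until only \<open>Z (C v)\<close> is left.\<close>

lemma invariant_core_invariant:
  assumes "endo Z" "endo K" "endo B"
    and Z: "\<And>v. v \<in> invariant_core Z K B \<Longrightarrow> Z (C v) = 0"
    and K: "\<And>v. v \<in> invariant_core Z K B \<Longrightarrow> K (C v) - scale r (C (K v)) \<in> invariant_core Z K B"
    and B: "\<And>v. v \<in> invariant_core Z K B \<Longrightarrow> B (C v) - scale r (C (B v)) \<in> invariant_core Z K B"
    and v: "v \<in> invariant_core Z K B"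
  shows "C v \<in> invariant_core Z K B"
proof -
  let ?f = "\<lambda>b. if b then K else B"
  have "Z (fold ?f w (C v)) = 0" for w
    using v
  proof (induction w arbitrary: v)
    case Nil
    then show ?case using Z by simp
  next
    case (Cons b w)
    have core: "?f b v \<in> invariant_core Z K B" using Cons.prems invariant_core_K invariant_core_B by auto
    have "?f b (C v) - scale r (C (?f b v)) \<in> invariant_core Z K B" using Cons.prems K B by auto
    then have "Z (fold ?f w (?f b (C v) - scale r (C (?f b v)))) = 0"
      by (simp add: invariant_core_def)
    then have "Z (fold ?f w (?f b (C v))) = scale r (Z (fold ?f w (C (?f b v))))"
      by (simp add: endo_simps[OF assms(1)] endo_simps[OF endo_fold[OF assms(2,3)]])
    then show ?case using Cons.IH[OF core] by simp
  qed
  then show ?thesis by (simp add: invariant_core_def)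
qed

lemma q_defect_eq_0:
  assumes K: "endo K" and B: "endo B" and A: "endo A" and As: "endo As"
    and p: "p \<noteq> 0" and c: "c \<noteq> 1"
    and KA: "\<And>v. scale p (K (A v)) = A (K v) + scale c (K (K v)) + scale 1 v"
    and BA: "\<And>v. scale p (B (A v)) = A (B v) + scale 1 (B (B v)) + scale c v"
    and KAs: "\<And>v. scale p (As (K v)) = K (As v) + scale e (K (K v)) + scale 1 v"
    and BAs: "\<And>v. scale p (As (B v)) = B (As v) + scale e (B (B v)) + scale 1 v"
    and irreducible: "\<And>W. subspace W \<Longrightarrow> A ` W \<subseteq> W \<Longrightarrow> As ` W \<subseteq> W \<Longrightarrow> W = {0} \<or> W = UNIV"
    and v0: "v0 \<noteq> 0" "K v0 = scale t v0" "B v0 = scale t v0"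
  shows "q_defect p c K B v = 0"
proof -
  define Z where "Z = q_defect p c K B"
  have Z: "endo Z" unfolding Z_def by (rule endo_q_defect[OF K B])
  define N where "N = invariant_core Z K B"
  have N: "subspace N" unfolding N_def by (rule subspace_invariant_core[OF Z K B])
  have NK: "K v \<in> N" and NB: "B v \<in> N" and NZ: "Z v = 0" if "v \<in> N" for v
    using that unfolding N_def by (rule invariant_core_K invariant_core_B invariant_core_D)+
  \<comment> \<open>For \<open>v\<close> in \<open>N\<close> every term on the right of
    \<open>q_defect_commute_A\<close> vanishes, and \<open>(1 - c) * (p * p)\<close> is
    nonzero.\<close>
  have "Z (A v) = 0" if "v \<in> N" for v
    using q_defect_commute_A[OF K B A KA BA, of v] NZ NK NB that p c
    by (simp add: endo_simps[OF A] endo_simps[OF K] endo_simps[OF B] flip: Z_def)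
  moreover have "K (A v) - scale (inverse p) (A (K v)) \<in> N" if "v \<in> N" for v
  proof -
    have "scale p (K (A v) - scale (inverse p) (A (K v))) = scale c (K (K v)) + v"
      using p KA[of v] by (simp add: scale_right_diff_distrib)
    also have "\<dots> \<in> N" using that N NK by (simp add: subspace_add subspace_scale)
    finally have "scale (inverse p) (scale p (K (A v) - scale (inverse p) (A (K v)))) \<in> N"
      by (rule subspace_scale[OF N])
    then show ?thesis using p by simp
  qed
  moreover have "B (A v) - scale (inverse p) (A (B v)) \<in> N" if "v \<in> N" for v
  proof -
    have "scale p (B (A v) - scale (inverse p) (A (B v))) = B (B v) + scale c v"
      using p BA[of v] by (simp add: scale_right_diff_distrib)
    also have "\<dots> \<in> N" using that N NB by (simp add: subspace_add subspace_scale)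
    finally have "scale (inverse p) (scale p (B (A v) - scale (inverse p) (A (B v)))) \<in> N"
      by (rule subspace_scale[OF N])
    then show ?thesis using p by simp
  qed
  ultimately have 1: "A ` N \<subseteq> N"
    unfolding N_def using invariant_core_invariant[OF Z K B] by blast
  have "Z (As v) = 0" if "v \<in> N" for v
    using q_defect_commute_As[OF K B As KAs BAs, of c v] NZ NK NB that p c
    by (simp add: endo_simps[OF As] endo_simps[OF K] endo_simps[OF B] flip: Z_def)
  \<comment> \<open>The exchange scalar is \<open>p\<close> here but \<open>inverse p\<close> for
    \<open>A\<close>: the factor \<open>p\<close> stands at \<open>As (K v)\<close> in one relation
    and at \<open>K (A v)\<close> in the other.\<close>
  moreover have "K (As v) - scale p (As (K v)) \<in> N" if "v \<in> N" for v
  proof -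
    have "K (As v) - scale p (As (K v)) = - (scale e (K (K v)) + v)"
      by (simp add: KAs)
    also have "\<dots> \<in> N"
      using that N NK by (intro subspace_neg subspace_add subspace_scale) auto
    finally show ?thesis .
  qed
  moreover have "B (As v) - scale p (As (B v)) \<in> N" if "v \<in> N" for v
  proof -
    have "B (As v) - scale p (As (B v)) = - (scale e (B (B v)) + v)"
      by (simp add: BAs)
    also have "\<dots> \<in> N"
      using that N NB by (intro subspace_neg subspace_add subspace_scale) auto
    finally show ?thesis .
  qed
  ultimately have 2: "As ` N \<subseteq> N"
    unfolding N_def using invariant_core_invariant[OF Z K B] by blast
  \<comment> \<open>\<open>K\<close> and \<open>B\<close> both act as \<open>t\<close> on the line
    through \<open>v0\<close>, and the four signed coefficients of \<open>q_defect\<close> add up to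
    zero.\<close>
  have "Z (scale s v0) = 0" for s
    by (simp add: Z_def q_defect_def v0 endo_simps[OF K] endo_simps[OF B] algebra_simps)
  moreover have "\<exists>s. fold (\<lambda>b. if b then K else B) w (scale s' v0) = scale s v0" for w s'
    by (induction w arbitrary: s') (auto simp: v0 endo_simps[OF K] endo_simps[OF B])
  then have "\<exists>s. fold (\<lambda>b. if b then K else B) w v0 = scale s v0" for w
    by (metis scale_one)
  ultimately have "v0 \<in> N" unfolding N_def invariant_core_def by clarify metis
  with irreducible[OF N 1 2] v0 have "N = UNIV" by blast
  then show ?thesis using NZ by (simp add: Z_def)
qed

section \<open>The \<open>q\<close>-exponential\<close>

lemma endo_scaled: "endo f \<Longrightarrow> endo (\<lambda>v. scale c (f v))"
  by (rule endoI) (simp_all add: endo_simps scale_right_distrib mult.commute)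

lemma q_exp_sum:
  fixes d :: nat
  assumes T: "endo T" and nil: "T ^^ Suc d = (\<lambda>_. 0)"
  shows "q_exp scale q T v = (\<Sum>n\<le>d. scale (q ^ (n choose 2) / q_fact q n) ((T ^^ n) v))"
proof -
  have zero: "(T ^^ k) 0 = 0" for k
    by (induction k) (simp_all add: endo_simps[OF T])
  have "T ^^ n = (\<lambda>_. 0)" if "d < n" for n
  proof -
    have "T ^^ n = T ^^ (n - Suc d) \<circ> T ^^ Suc d"
      using that by (simp flip: funpow_add del: funpow.simps)
    then show ?thesis by (simp add: nil zero fun_eq_iff del: funpow.simps)
  qed
  then have "{n. T ^^ n \<noteq> (\<lambda>_. 0)} \<subseteq> {..d}" by (auto simp: not_less[symmetric])
  then show ?thesis unfolding q_exp_def by (intro sum.mono_neutral_left) auto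
qed

text \<open>The functional equation of the \<open>q\<close>-exponential, compared at
  \<open>T ^^ Suc m\<close>. It reduces to \<open>q_int q (Suc m) * (q ^ m * (q\<^sup>2 - 1)) = q ^
  (2 * Suc m) - 1\<close>.\<close>

lemma q_exp_coefficient_Suc:
  fixes q :: 'k
  assumes "q \<noteq> 0" "q_int q (Suc m) \<noteq> 0"
  shows "q ^ (Suc m choose 2) / q_fact q (Suc m) * (q ^ (2 * Suc m) - 1)
    = q ^ (m choose 2) / q_fact q m * q ^ (2 * m) * (q\<^sup>2 - 1)"
proof -
  have "q - inverse q \<noteq> 0" using assms by (auto simp: q_int_def)
  then have "q_int q (Suc m) * (q ^ m * (q\<^sup>2 - 1)) = q ^ (2 * Suc m) - 1"
    using \<open>q \<noteq> 0\<close>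
    by (simp add: q_int_def divide_simps power2_eq_square)
      (simp add: field_simps power_mult power2_eq_square flip: power_mult_distrib)
  moreover have "Suc m choose 2 = (m choose 2) + m"
    by (simp add: numeral_2_eq_2)
  moreover have "q_fact q (Suc m) = q_int q (Suc m) * q_fact q m"
    by (simp add: q_fact_def mult.commute)
  ultimately show ?thesis
    using assms(2) by (simp add: power_add mult_2 divide_simps) (simp add: algebra_simps)
qed

text \<open>Passing \<open>M\<close> through \<open>T ^^ n\<close> costs \<open>q ^ (2 * n)\<close>,
  so the claim becomes the functional equation applied to \<open>M v\<close>.\<close>

lemma q_exp_intertwines:
  fixes d :: nat and q :: 'k
  assumes T: "endo T" and K: "endo K" and nil: "T ^^ Suc d = (\<lambda>_. 0)" and q: "q \<noteq> 0"
    and q_int: "\<And>n. 1 \<le> n \<Longrightarrow> n \<le> d \<Longrightarrow> q_int q n \<noteq> 0"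
    and KM: "\<And>v. K v = M v - scale (q\<^sup>2 - 1) (T (M v))"
    and MT: "\<And>v. M (T v) = scale (q\<^sup>2) (T (M v))"
  shows "K \<circ> q_exp scale q T = q_exp scale q T \<circ> M"
proof
  fix v
  define w where "w = M v"
  define g where "g = (\<lambda>n. q ^ (n choose 2) / q_fact q n)"
  have M_power: "M ((T ^^ n) v) = scale (q ^ (2 * n)) ((T ^^ n) w)" for n
    by (induction n) (simp_all add: w_def MT endo_simps[OF T] power2_eq_square mult_ac)
  have K_power: "K ((T ^^ n) v)
      = scale (q ^ (2 * n)) ((T ^^ n) w - scale (q\<^sup>2 - 1) ((T ^^ Suc n) w))" for n
    by (simp add: KM M_power endo_simps[OF T] scale_right_diff_distrib mult_ac)
  \<comment> \<open>The functional equation truncated at \<open>m\<close>, by telescoping; the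
    remainder carries \<open>T ^^ Suc m\<close> and vanishes at \<open>m = d\<close>.\<close>
  have partial: "(\<Sum>n\<le>m. scale (g n * q ^ (2 * n)) ((T ^^ n) w - scale (q\<^sup>2 - 1) ((T ^^ Suc n) w)))
      = (\<Sum>n\<le>m. scale (g n) ((T ^^ n) w)) - scale (g m * q ^ (2 * m) * (q\<^sup>2 - 1)) ((T ^^ Suc m) w)"
    if "m \<le> d" for m
    using that
  proof (induction m)
    case 0
    show ?case by (simp add: scale_right_diff_distrib q_fact_def g_def)
  next
    case (Suc m)
    have "g m * q ^ (2 * m) * (q\<^sup>2 - 1) = g (Suc m) * (q ^ (2 * Suc m) - 1)"
      unfolding g_def by (rule q_exp_coefficient_Suc[symmetric]) (use q q_int Suc.prems in auto)
    with Suc have IH: "(\<Sum>n\<le>m. scale (g n * q ^ (2 * n))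
          ((T ^^ n) w - scale (q\<^sup>2 - 1) ((T ^^ Suc n) w)))
        = (\<Sum>n\<le>m. scale (g n) ((T ^^ n) w))
          - scale (g (Suc m) * (q ^ (2 * Suc m) - 1)) ((T ^^ Suc m) w)"
      by simp
    show ?case
      unfolding sum.atMost_Suc IH
      by (simp del: funpow.simps power_Suc mult_Suc_right add: scale_right_diff_distrib
          scale_left_diff_distrib right_diff_distrib)
  qed
  have "K (q_exp scale q T v) = (\<Sum>n\<le>d. scale (g n) (K ((T ^^ n) v)))"
    by (simp add: q_exp_sum[OF T nil] endo_simps[OF K] g_def)
  also have "\<dots> = q_exp scale q T w"
    using partial[of d] by (simp del: funpow.simps add: K_power q_exp_sum[OF T nil] g_def nil)
  finally show "(K \<circ> q_exp scale q T) v = (q_exp scale q T \<circ> M) v"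
    by (simp add: w_def)
qed

end

section \<open>Tridiagonal systems and their split decompositions\<close>

text \<open>A TD system told through its idempotents: tridiagonality becomes the vanishing of blocks
  whose indices are more than one apart.\<close>

locale td_data = endomorphisms scale
  for scale :: "'k::field \<Rightarrow> 'v::ab_group_add \<Rightarrow> 'v" +
  fixes d :: nat and A As :: "'v \<Rightarrow> 'v" and E Es :: "nat \<Rightarrow> 'v \<Rightarrow> 'v" and th ths :: "nat \<Rightarrow> 'k"
  assumes A: "endo A" and As: "endo As"
    and E: "i \<le> d \<Longrightarrow> endo (E i)" and Es: "i \<le> d \<Longrightarrow> endo (Es i)"
    and E_E: "i \<le> d \<Longrightarrow> j \<le> d \<Longrightarrow> E i (E j v) = (if i = j then E j v else 0)"
    and Es_Es: "i \<le> d \<Longrightarrow> j \<le> d \<Longrightarrow> Es i (Es j v) = (if i = j then Es j v else 0)"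
    and sum_E: "(\<Sum>i\<le>d. E i v) = v" and sum_Es: "(\<Sum>i\<le>d. Es i v) = v"
    and E_A: "i \<le> d \<Longrightarrow> E i (A v) = scale (th i) (E i v)"
    and Es_As: "i \<le> d \<Longrightarrow> Es i (As v) = scale (ths i) (Es i v)"
    and E_As_E: "i \<le> d \<Longrightarrow> j \<le> d \<Longrightarrow> Suc j < i \<or> Suc i < j \<Longrightarrow> E j (As (E i v)) = 0"
    and Es_A_Es: "i \<le> d \<Longrightarrow> j \<le> d \<Longrightarrow> Suc j < i \<or> Suc i < j \<Longrightarrow> Es j (A (Es i v)) = 0"
    and irreducible: "subspace W \<Longrightarrow> A ` W \<subseteq> W \<Longrightarrow> As ` W \<subseteq> W \<Longrightarrow> W = {0} \<or> W = UNIV"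
    and Es_0_nonzero: "\<exists>v. Es 0 v \<noteq> 0" and Es_d_nonzero: "\<exists>v. Es d v \<noteq> 0"

text \<open>The conditions on \<open>E\<close> involve indices only through equality and distance,
  so they survive a reversal of the order. This reduces the second split decomposition to the
  first.\<close>

lemma (in td_data) td_data_reverse: "td_data scale d A As (\<lambda>i. E (d - i)) Es (\<lambda>i. th (d - i)) ths"
proof (intro td_data.intro endomorphisms_axioms td_data_axioms.intro)
  show "(\<Sum>i\<le>d. E (d - i) v) = v" for v
    using sum.nat_diff_reindex[of "\<lambda>i. E i v" "Suc d"] sum_E[of v]
    by (simp add: lessThan_Suc_atMost)
  show "E (d - i) (E (d - j) v) = (if i = j then E (d - j) v else 0)" if "i \<le> d" "j \<le> d" for i j v
    using that by (auto simp: E_E)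
  show "E (d - j) (As (E (d - i) v)) = 0"
    if "i \<le> d" "j \<le> d" "Suc j < i \<or> Suc i < j" for i j v
    using that by (intro E_As_E) auto
  show "W = {0} \<or> W = UNIV" if "subspace W" "A ` W \<subseteq> W" "As ` W \<subseteq> W" for W
    using that by (rule irreducible)
  show "endo A" "endo As" by (fact A As)+
  show "\<exists>v. Es 0 v \<noteq> 0" "\<exists>v. Es d v \<noteq> 0" by (fact Es_0_nonzero Es_d_nonzero)+
qed (simp_all add: E Es Es_Es sum_Es E_A Es_As Es_A_Es)

context td_data
begin

lemmas td_data_endo_simps [simp] = endo_simps[OF A] endo_simps[OF As] endo_simps[OF E] endo_simps[OF Es]

text \<open>\<open>H i = E\<^sub>0\<^sup>*V + \<dots> + E\<^sup>*\<^bsub>i-1\<^esub>V\<close> and \<open>G i = E\<^sub>iV + \<dots> + E\<^sub>dV\<close>; the shift in \<open>H\<close> makes \<open>H 0\<close> zero.\<close>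

definition H :: "nat \<Rightarrow> 'v set" where "H i = {v. \<forall>j\<le>d. i \<le> j \<longrightarrow> Es j v = 0}"

definition G :: "nat \<Rightarrow> 'v set" where "G i = {v. \<forall>j\<le>d. j < i \<longrightarrow> E j v = 0}"

lemma subspace_H: "subspace (H i)" and subspace_G: "subspace (G i)"
  by (auto simp: subspace_def H_def G_def)

lemma E_eq_0D:
  assumes "\<And>i. i \<le> d \<Longrightarrow> E i v = 0"
  shows "v = 0"
proof -
  have "(\<Sum>i\<le>d. E i v) = 0" using assms by (intro sum.neutral) simp
  then show ?thesis by (simp only: sum_E)
qed

lemma Es_eq_0D:
  assumes "\<And>i. i \<le> d \<Longrightarrow> Es i v = 0"
  shows "v = 0"
proof -
  have "(\<Sum>i\<le>d. Es i v) = 0" using assms by (intro sum.neutral) simp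
  then show ?thesis by (simp only: sum_Es)
qed

lemma H_0: "H 0 = {0}"
proof
  show "H 0 \<subseteq> {0}"
  proof
    fix v assume "v \<in> H 0"
    have "v = 0" by (rule Es_eq_0D) (use \<open>v \<in> H 0\<close> in \<open>simp add: H_def\<close>)
    then show "v \<in> {0}" by simp
  qed
  show "{0} \<subseteq> H 0" by (simp add: subspace_0[OF subspace_H])
qed

lemma G_beyond: "d < i \<Longrightarrow> G i = {0}"
proof
  assume "d < i"
  show "G i \<subseteq> {0}"
  proof
    fix v assume "v \<in> G i"
    have "v = 0" by (rule E_eq_0D) (use \<open>d < i\<close> \<open>v \<in> G i\<close> in \<open>simp add: G_def\<close>)
    then show "v \<in> {0}" by simp
  qed
  show "{0} \<subseteq> G i" by (simp add: subspace_0[OF subspace_G])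
qed

lemma G_0: "G 0 = UNIV" and H_Suc_d: "H (Suc d) = UNIV"
  by (simp_all add: G_def H_def)

lemma H_mono: "i \<le> j \<Longrightarrow> H i \<subseteq> H j" and G_mono: "i \<le> j \<Longrightarrow> G j \<subseteq> G i"
  by (auto simp: H_def G_def)

lemma G_step: "v \<in> G i \<Longrightarrow> A v - scale (th i) v \<in> G (Suc i)"
  by (auto simp: G_def E_A less_Suc_eq)

lemma H_step: "v \<in> H (Suc i) \<Longrightarrow> As v - scale (ths i) v \<in> H i"
  by (auto simp: H_def Es_As le_less Suc_le_eq)

text \<open>Expand \<open>v\<close> by the \<open>Es k\<close>: a component of index
  \<open>k < i\<close> is carried by \<open>A\<close> at most to index \<open>k + 1\<close>.\<close>

lemma A_H: "v \<in> H i \<Longrightarrow> A v \<in> H (Suc i)"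
proof -
  assume v: "v \<in> H i"
  have "Es j (A v) = 0" if "j \<le> d" "Suc i \<le> j" for j
  proof -
    have "Es j (A v) = Es j (A (\<Sum>k\<le>d. Es k v))" by (simp add: sum_Es)
    also have "\<dots> = (\<Sum>k\<le>d. Es j (A (Es k v)))" using that by simp
    also have "\<dots> = 0"
    proof (intro sum.neutral ballI)
      fix k assume "k \<in> {..d}"
      then show "Es j (A (Es k v)) = 0"
        using that v Es_A_Es[of k j v] by (cases "Suc k < j") (auto simp: H_def)
    qed
    finally show ?thesis .
  qed
  then show ?thesis by (simp add: H_def)
qed

lemma As_G: "v \<in> G (Suc i) \<Longrightarrow> As v \<in> G i"
proof -
  assume v: "v \<in> G (Suc i)"
  have "E j (As v) = 0" if "j \<le> d" "j < i" for j
  proof -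
    have "E j (As v) = E j (As (\<Sum>k\<le>d. E k v))" by (simp add: sum_E)
    also have "\<dots> = (\<Sum>k\<le>d. E j (As (E k v)))" using that by simp
    also have "\<dots> = 0"
    proof (intro sum.neutral ballI)
      fix k assume "k \<in> {..d}"
      then show "E j (As (E k v)) = 0"
        using that v E_As_E[of k j v] by (cases "Suc j < k") (auto simp: G_def)
    qed
    finally show ?thesis .
  qed
  then show ?thesis by (simp add: G_def)
qed

definition U :: "nat \<Rightarrow> 'v set" where "U i = H (Suc i) \<inter> G i"

lemma subspace_U: "subspace (U i)"
  by (simp add: U_def subspace_H subspace_G subspace_inter)

text \<open>Subtracting \<open>th i\<close> removes the \<open>E i\<close> component and so advances
  the flag \<open>G\<close>, while \<open>A\<close> widens \<open>H\<close> by one step. In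
  \<open>U_As\<close> the two flags exchange roles.\<close>

lemma U_A: "u \<in> U i \<Longrightarrow> A u - scale (th i) u \<in> U (Suc i)"
  unfolding U_def using A_H[of u "Suc i"] H_mono[of "Suc i" "Suc (Suc i)"] G_step[of u i]
  by (auto intro!: subspace_diff[OF subspace_H] subspace_scale[OF subspace_H])

lemma U_As: "u \<in> U (Suc i) \<Longrightarrow> As u - scale (ths (Suc i)) u \<in> U i"
  unfolding U_def using As_G[of u i] G_mono[of i "Suc i"] H_step[of u "Suc i"]
  by (auto intro!: subspace_diff[OF subspace_G] subspace_scale[OF subspace_G])

lemma U_As_0: "u \<in> U 0 \<Longrightarrow> As u = scale (ths 0) u"
  unfolding U_def using H_step[of u 0] by (auto simp: H_0)

lemma U_beyond: "d < i \<Longrightarrow> U i = {0}"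
  using G_beyond subspace_0[OF subspace_H] by (auto simp: U_def)

section \<open>Directness of the split decomposition\<close>

lemma span_Union_invariant:
  assumes "endo f" and step: "\<And>i v. i \<le> d \<Longrightarrow> v \<in> X i \<Longrightarrow> f v \<in> span (\<Union>i\<le>(d::nat). X i)"
  shows "f ` span (\<Union>i\<le>d. X i) \<subseteq> span (\<Union>i\<le>d. X i)"
proof clarify
  fix v assume "v \<in> span (\<Union>i\<le>d. X i)"
  then show "f v \<in> span (\<Union>i\<le>d. X i)"
    by (induction rule: span_induct_alt)
      (use step in \<open>auto simp: endo_simps[OF \<open>endo f\<close>] span_zero intro!: span_add span_scale\<close>)
qed

text \<open>The span is invariant by \<open>U_A\<close> and \<open>U_As\<close>, and nonzero because
  \<open>U 0\<close> contains the range of \<open>Es 0\<close>; irreducibility leaves only the whole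
  space.\<close>

lemma span_Union_U: "span (\<Union>i\<le>d. U i) = UNIV"
proof -
  let ?W = "span (\<Union>i\<le>d. U i)"
  \<comment> \<open>Indices above \<open>d\<close> are included because \<open>A\<close> may lead
    from \<open>U d\<close> to \<open>U (Suc d)\<close>.\<close>
  have U_sub: "U i \<subseteq> ?W" for i
    by (cases "i \<le> d") (auto intro: span_base simp: U_beyond span_zero)
  have "A u \<in> ?W" if "u \<in> U i" for i u
    using span_add[OF subsetD[OF U_sub U_A[OF that]] span_scale[OF subsetD[OF U_sub that], of "th i"]]
    by simp
  then have 1: "A ` ?W \<subseteq> ?W" by (intro span_Union_invariant A)
  have "As u \<in> ?W" if "u \<in> U i" for i u
  proof (cases i)
    case 0
    then show ?thesis using that U_sub by (auto simp: U_As_0 intro!: span_scale)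
  next
    case (Suc k)
    with that have "As u - scale (ths i) u \<in> ?W" using U_As U_sub by blast
    then show ?thesis
      using span_add[OF _ span_scale[OF subsetD[OF U_sub that], of "ths i"]] by fastforce
  qed
  then have 2: "As ` ?W \<subseteq> ?W" by (intro span_Union_invariant As)
  obtain v where v: "Es 0 v \<noteq> 0" using Es_0_nonzero by blast
  have "Es 0 v \<in> U 0" by (auto simp: U_def G_0 H_def Es_Es)
  then have "?W \<noteq> {0}" using v U_sub by blast
  then show ?thesis using irreducible[OF subspace_span 1 2] by blast
qed

text \<open>The sum of the \<open>H i \<inter> G i\<close> is invariant under \<open>A\<close> and \<open>A\<^sup>*\<close> but contained in \<open>H d \<noteq> V\<close>.\<close>

lemma H_Int_G: "H i \<inter> G i = {0}"
proof -
  define X where "X = (\<lambda>i. H i \<inter> G i)"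
  let ?W = "span (\<Union>i\<le>d. X i)"
  have sub: "subspace (X i)" for i
    by (simp add: X_def subspace_H subspace_G subspace_inter)
  have X_beyond: "X i = {0}" if "d < i" for i
    using that subspace_0[OF subspace_H] by (auto simp: X_def G_beyond)
  have X_sub: "X i \<subseteq> ?W" for i
    by (cases "i \<le> d") (auto intro: span_base simp: X_beyond span_zero)
  have "A v \<in> ?W" if v: "v \<in> X i" for i v
  proof -
    have "A v - scale (th i) v \<in> X (Suc i)"
      using v A_H[of v i] H_mono[of i "Suc i"] G_step[of v i]
      by (auto simp: X_def intro!: subspace_diff[OF subspace_H] subspace_scale[OF subspace_H])
    then show ?thesis
      using span_add[OF subsetD[OF X_sub] span_scale[OF subsetD[OF X_sub v], of "th i"]] by fastforce
  qed
  then have 1: "A ` ?W \<subseteq> ?W" by (intro span_Union_invariant A)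
  have "As v \<in> ?W" if v: "v \<in> X i" for i v
  proof (cases i)
    case 0
    then show ?thesis using v by (auto simp: X_def H_0 span_zero)
  next
    case (Suc k)
    \<comment> \<open>\<open>H (Suc k)\<close> stops at \<open>Es k\<close>, so the eigenvalue to
      subtract is \<open>ths k\<close>, one index lower than in \<open>U_As\<close>.\<close>
    have "As v - scale (ths k) v \<in> X k"
      using v As_G[of v k] G_mono[of k "Suc k"] H_step[of v k] Suc
      by (auto simp: X_def intro!: subspace_diff[OF subspace_G] subspace_scale[OF subspace_G])
    then show ?thesis
      using span_add[OF subsetD[OF X_sub] span_scale[OF subsetD[OF X_sub v], of "ths k"]] by fastforce
  qed
  then have 2: "As ` ?W \<subseteq> ?W" by (intro span_Union_invariant As)
  have "?W \<subseteq> H d"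
    by (rule span_minimal[OF _ subspace_H]) (use H_mono in \<open>auto simp: X_def\<close>)
  moreover obtain v where "Es d v \<noteq> 0" using Es_d_nonzero by blast
  then have "Es d v \<notin> H d" by (auto simp: H_def Es_Es)
  ultimately have "?W = {0}" using irreducible[OF subspace_span 1 2] by blast
  then show ?thesis
    using X_sub[of i] subspace_0[OF sub, of i] by (auto simp: X_def)
qed

text \<open>Descending induction on \<open>i\<close>: components of higher index already vanish,
  those of lower index and the total lie in \<open>H i\<close>, so \<open>f i\<close> lies in
  \<open>H i \<inter> G i\<close>. The case \<open>k = 0\<close> is the independence of the
  \<open>U i\<close>.\<close>

lemma sum_U_in_H:
  assumes "\<And>i. i \<le> d \<Longrightarrow> f i \<in> U i" "(\<Sum>i\<le>d. f i) \<in> H k"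
  shows "i \<le> d \<Longrightarrow> k \<le> i \<Longrightarrow> f i = 0"
proof (induction "d - i" arbitrary: i rule: less_induct)
  case less
  have "f i = (\<Sum>j\<le>d. f j) - (\<Sum>j\<in>{..d} - {i}. f j)"
    using less.prems by (subst sum.remove[where x=i]) auto
  also have "\<dots> \<in> H i"
  proof (rule subspace_diff[OF subspace_H _ subspace_sum[OF subspace_H]])
    show "(\<Sum>j\<le>d. f j) \<in> H i" using assms H_mono less.prems by blast
    fix j assume j: "j \<in> {..d} - {i}"
    show "f j \<in> H i"
    proof (cases "i < j")
      case True
      then have "f j = 0" using j less.prems by (intro less.hyps) auto
      then show ?thesis by (simp add: subspace_0[OF subspace_H])
    next
      case False
      then show ?thesis using assms(1)[of j] j H_mono[of "Suc j" i] by (auto simp: U_def)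
    qed
  qed
  finally have "f i \<in> H i \<inter> G i"
    using assms(1)[of i] less.prems by (simp add: U_def)
  then show ?case by (simp only: H_Int_G singleton_iff)
qed

section \<open>The \<open>U i\<close> as the given split decomposition\<close>

lemma range_Es_sum: "(\<Sum>j\<le>i. range (Es j)) = H (Suc i)" if "i \<le> d"
proof -
  have "v \<in> H (Suc i)" if f: "v = sum f {..i}" "\<forall>j\<in>{..i}. f j \<in> range (Es j)" for v f
    unfolding f(1)
  proof (rule subspace_sum[OF subspace_H])
    fix j assume "j \<in> {..i}"
    with f obtain w where "f j = Es j w" by blast
    with \<open>j \<in> {..i}\<close> \<open>i \<le> d\<close> show "f j \<in> H (Suc i)" by (simp add: H_def Es_Es)
  qed
  moreover have "\<exists>f. v = sum f {..i} \<and> (\<forall>j\<in>{..i}. f j \<in> range (Es j))" if "v \<in> H (Suc i)" for v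
  proof (rule exI[of _ "\<lambda>j. Es j v"], intro conjI)
    have "v = (\<Sum>j\<le>d. Es j v)" by (simp add: sum_Es)
    also have "\<dots> = (\<Sum>j\<le>i. Es j v)"
      by (rule sum.mono_neutral_right) (use that \<open>i \<le> d\<close> in \<open>auto simp: H_def\<close>)
    finally show "v = (\<Sum>j\<le>i. Es j v)" .
  qed auto
  ultimately show ?thesis by (auto simp: set_sum_alt)
qed

lemma range_E_sum: "(\<Sum>j=i..d. range (E j)) = G i"
proof -
  have "v \<in> G i" if f: "v = sum f {i..d}" "\<forall>j\<in>{i..d}. f j \<in> range (E j)" for v f
    unfolding f(1)
  proof (rule subspace_sum[OF subspace_G])
    fix j assume "j \<in> {i..d}"
    with f obtain w where "f j = E j w" by blast
    with \<open>j \<in> {i..d}\<close> show "f j \<in> G i" by (simp add: G_def E_E)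
  qed
  moreover have "\<exists>f. v = sum f {i..d} \<and> (\<forall>j\<in>{i..d}. f j \<in> range (E j))" if "v \<in> G i" for v
  proof (rule exI[of _ "\<lambda>j. E j v"], intro conjI)
    have "v = (\<Sum>j\<le>d. E j v)" by (simp add: sum_E)
    also have "\<dots> = (\<Sum>j=i..d. E j v)"
      by (rule sum.mono_neutral_right) (use that in \<open>auto simp: G_def\<close>)
    finally show "v = (\<Sum>j=i..d. E j v)" .
  qed auto
  ultimately show ?thesis by (auto simp: set_sum_alt)
qed

lemma split_decomp_eq_U: "i \<le> d \<Longrightarrow> split_decomp d E Es i = U i"
  by (simp add: split_decomp_def U_def range_Es_sum range_E_sum atLeast0AtMost)

text \<open>\<open>T\<close> is triangular along the flag \<open>H\<close> with nonzero diagonal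
  \<open>y\<close>, so equations are solved from the bottom of the flag upward. Preimages are kept
  inside \<open>H i\<close> so that \<open>\<psi>\<close> can be traced along the flag.\<close>

lemma
  assumes T: "endo T" and step: "\<And>i v. i \<le> d \<Longrightarrow> v \<in> H (Suc i) \<Longrightarrow> T v - scale (y i) v \<in> H i"
    and y: "\<And>i. i \<le> d \<Longrightarrow> y i \<noteq> 0"
  shows triangular_surj: "i \<le> Suc d \<Longrightarrow> v \<in> H i \<Longrightarrow> \<exists>w\<in>H i. T w = v"
    and triangular_bij: "bij T"
proof -
  have surj: "\<exists>w\<in>H i. T w = v" if "i \<le> Suc d" "v \<in> H i" for i v
    using that
  proof (induction i arbitrary: v)
    case 0
    then show ?case by (auto simp: H_0 endo_simps[OF T])
  next
    case (Suc i)
    \<comment> \<open>A first approximation to a preimage; its error \<open>T u - v\<close> lies in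
      \<open>H i\<close>, where the induction hypothesis corrects it.\<close>
    define u where "u = scale (inverse (y i)) v"
    have u: "u \<in> H (Suc i)" using Suc.prems by (simp add: u_def subspace_scale[OF subspace_H])
    then have "T u - scale (y i) u \<in> H i" using step Suc.prems by simp
    moreover have "scale (y i) u = v" using y Suc.prems by (simp add: u_def)
    ultimately obtain w where w: "w \<in> H i" "T w = T u - v" using Suc by auto
    have "u - w \<in> H (Suc i)"
      using u w(1) H_mono[of i "Suc i"] by (auto intro: subspace_diff[OF subspace_H])
    moreover have "T (u - w) = v" by (simp add: endo_simps[OF T] w)
    ultimately show ?case by blast
  qed
  then show "i \<le> Suc d \<Longrightarrow> v \<in> H i \<Longrightarrow> \<exists>w\<in>H i. T w = v" .
  have kernel: "v = 0" if "i \<le> Suc d" "v \<in> H i" "T v = 0" for i v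
    using that
  proof (induction i)
    case 0
    then show ?case by (simp add: H_0)
  next
    case (Suc i)
    have "- scale (y i) v \<in> H i" using step[of i v] Suc.prems by simp
    then have "scale (- inverse (y i)) (- scale (y i) v) \<in> H i"
      by (rule subspace_scale[OF subspace_H])
    then have "v \<in> H i" using y[of i] Suc.prems by simp
    then show ?case using Suc by simp
  qed
  have "inj T"
  proof (rule injI)
    fix v w assume "T v = T w"
    then have "T (v - w) = 0" by (simp add: endo_simps[OF T])
    then have "v - w = 0" using kernel[of "Suc d" "v - w"] H_Suc_d by simp
    then show "v = w" by simp
  qed
  moreover have "surj T" using surj[of "Suc d"] unfolding H_Suc_d by (metis UNIV_I le_refl surj_def)
  ultimately show "bij T" by (simp add: bij_def)
qed

end

lemma split_operator_cong:
  "(\<And>i. i \<le> d \<Longrightarrow> U i = U' i) \<Longrightarrow> split_operator s d q U = split_operator s d q U'"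
  by (simp add: split_operator_def)

lemma split_decomp_down_eq:
  assumes "i \<le> d"
  shows "split_decomp_down d E Es i = split_decomp d (\<lambda>j. E (d - j)) Es i"
proof -
  have "(\<Sum>j=0..d-i. range (E j)) = (\<Sum>j=i..d. range (E (d - j)))"
    by (rule sum.reindex_bij_witness[where i="\<lambda>j. d - j" and j="\<lambda>j. d - j"])
      (use assms in auto)
  then show ?thesis by (simp add: split_decomp_down_def split_decomp_def)
qed

section \<open>Systems of \<open>q\<close>-Racah type\<close>

text \<open>\<open>inj_th\<close>, the distinctness of the eigenvalues, supplies the inequalities
  for powers of \<open>q\<close> and for \<open>a\<close> derived below.\<close>

locale td_racah = td_data scale d A As E Es th ths
  for scale :: "'k::field \<Rightarrow> 'v::ab_group_add \<Rightarrow> 'v"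
    and d :: nat and A As :: "'v \<Rightarrow> 'v" and E Es :: "nat \<Rightarrow> 'v \<Rightarrow> 'v" and th ths :: "nat \<Rightarrow> 'k" +
  fixes q a b :: 'k
  assumes q: "q \<noteq> 0" and a: "a \<noteq> 0" and b: "b \<noteq> 0"
    and d: "1 \<le> d" and inj_th: "inj_on th {..d}"
    and th: "i \<le> d \<Longrightarrow> th i = a * q powi (int d - 2 * int i) + inverse a * q powi (2 * int i - int d)"
    and ths: "i \<le> d \<Longrightarrow> ths i = b * q powi (int d - 2 * int i) + inverse b * q powi (2 * int i - int d)"
begin

text \<open>The scalar of \<open>K\<close> on \<open>U i\<close>, and the variable in which
  \<open>th i\<close> is \<open>a * x i + inverse a * inverse (x i)\<close>.\<close>

definition x :: "nat \<Rightarrow> 'k" where "x i = q powi (int d - 2 * int i)"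

lemma x_nonzero: "x i \<noteq> 0"
  using q by (simp add: x_def)

lemma x_Suc: "q\<^sup>2 * x (Suc i) = x i"
proof -
  have "q powi (int d - 2 * int i) = q powi (2 + (int d - 2 * int (Suc i)))" by simp
  also have "\<dots> = q powi 2 * q powi (int d - 2 * int (Suc i))"
    using q by (subst power_int_add) auto
  finally show ?thesis by (simp add: x_def)
qed

lemma inverse_x: "q powi (2 * int i - int d) = inverse (x i)"
  using power_int_minus[of q "int d - 2 * int i"] by (simp add: x_def)

lemma th_x: "i \<le> d \<Longrightarrow> th i = a * x i + inverse a * inverse (x i)"
  by (simp add: th inverse_x flip: x_def)

lemma ths_x: "i \<le> d \<Longrightarrow> ths i = b * x i + inverse b * inverse (x i)"
  by (simp add: ths inverse_x flip: x_def)

section \<open>The operator \<open>K\<close> and its relations with \<open>A\<close> and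
  \<open>As\<close>\<close>

definition K :: "'v \<Rightarrow> 'v" where "K = split_operator scale d q (split_decomp d E Es)"

lemma K_eq: "K = split_operator scale d q U"
  unfolding K_def by (rule split_operator_cong) (rule split_decomp_eq_U)

lemma sum_U_eq_0:
  assumes "\<And>i. i \<le> d \<Longrightarrow> f i \<in> U i" "(\<Sum>i\<le>d. f i) = 0"
  shows "\<forall>i\<le>d. f i = 0"
  using sum_U_in_H[of f 0] assms by (simp add: H_0)

lemmas split_facts = split_operator_direct_sum[OF subspace_U span_Union_U sum_U_eq_0]

lemma endo_K: "endo K"
  unfolding K_eq by (rule split_facts(1))

lemma K_U: "i \<le> d \<Longrightarrow> u \<in> U i \<Longrightarrow> K u = scale (x i) u"
  unfolding K_eq x_def by (rule split_facts(2))

lemma sum_U: "\<exists>f. (\<forall>i\<le>d. f i \<in> U i) \<and> v = (\<Sum>i\<le>d. f i)"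
  by (rule split_facts(3))

lemmas K_simps = endo_simps[OF endo_K]

text \<open>By \<open>sum_U_in_H\<close> a vector of \<open>H (Suc i)\<close> has components only in
  \<open>U 0\<close> to \<open>U i\<close>; those below \<open>i\<close> lie in \<open>H i\<close>,
  and the last is cancelled. So \<open>K\<close> is triangular along \<open>H\<close> with diagonal
  \<open>x\<close>.\<close>

lemma K_H:
  assumes "i \<le> d" "v \<in> H (Suc i)"
  shows "K v - scale (x i) v \<in> H i"
proof -
  obtain f where f: "\<And>j. j \<le> d \<Longrightarrow> f j \<in> U j" "v = (\<Sum>j\<le>d. f j)" using sum_U by blast
  have "K v - scale (x i) v = (\<Sum>j\<le>d. scale (x j - x i) (f j))"
    using f by (simp add: K_simps K_U scale_sum_right sum_subtractf scale_left_diff_distrib)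
  also have "\<dots> \<in> H i"
  proof (rule subspace_sum[OF subspace_H])
    fix j assume "j \<in> {..d}"
    then have j: "j \<le> d" by simp
    consider "j < i" | "j = i" | "i < j" by linarith
    then show "scale (x j - x i) (f j) \<in> H i"
    proof cases
      case 1
      then show ?thesis
        using f(1)[OF j] H_mono[of "Suc j" i]
        by (auto simp: U_def intro: subspace_scale[OF subspace_H])
    next
      case 2
      then show ?thesis by (simp add: subspace_0[OF subspace_H])
    next
      case 3
      then have "f j = 0" using sum_U_in_H[of f "Suc i" j] f assms j by simp
      then show ?thesis by (simp add: subspace_0[OF subspace_H])
    qed
  qed
  finally show ?thesis .
qed

text \<open>On \<open>U i\<close> write \<open>A u = scale (th i) u + r\<close> with
  \<open>r\<close> in \<open>U (Suc i)\<close>. The \<open>r\<close> terms agree because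
  \<open>q\<^sup>2 * x (Suc i) = x i\<close>; the identity
  \<open>th i * x i = a * (x i * x i) + inverse a\<close> accounts for the rest.\<close>

lemma K_A:
  "scale (q\<^sup>2) (K (A v)) = A (K v) + scale (q\<^sup>2 - 1) (scale a (K (K v)) + scale (inverse a) v)"
proof (rule endo_eq_on_span_UNIV[where f="\<lambda>v. scale (q\<^sup>2) (K (A v))"
      and g="\<lambda>v. A (K v) + scale (q\<^sup>2 - 1) (scale a (K (K v)) + scale (inverse a) v)",
      OF _ _ _ span_Union_U])
  show "endo (\<lambda>v. scale (q\<^sup>2) (K (A v)))"
    and "endo (\<lambda>v. A (K v) + scale (q\<^sup>2 - 1) (scale a (K (K v)) + scale (inverse a) v))"
    by (rule endoI; simp add: K_simps scale_right_distrib algebra_simps)+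
  fix u assume "u \<in> (\<Union>i\<le>d. U i)"
  then obtain i where i: "i \<le> d" "u \<in> U i" by blast
  define r where "r = A u - scale (th i) u"
  have Au: "A u = scale (th i) u + r" by (simp add: r_def)
  have "r \<in> U (Suc i)" unfolding r_def using i by (intro U_A)
  \<comment> \<open>For \<open>i = d\<close> the remainder lies in \<open>U (Suc d)\<close> and is
    zero.\<close>
  then have Kr: "K r = scale (x (Suc i)) r"
    by (cases "Suc i \<le> d") (simp_all add: K_U U_beyond K_simps)
  have th: "th i * x i = a * (x i * x i) + inverse a"
    using i x_nonzero[of i] by (simp add: th_x field_simps)
  have "scale (q\<^sup>2) (K (A u)) = scale (q\<^sup>2 * (th i * x i)) u + scale (x i) r"
    by (simp add: Au K_simps Kr K_U[OF i] scale_right_distrib x_Suc)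
  also have "\<dots> = A (K u) + scale (q\<^sup>2 - 1) (scale (th i * x i) u)"
    by (simp add: K_U[OF i] Au algebra_simps)
  finally show "scale (q\<^sup>2) (K (A u))
      = A (K u) + scale (q\<^sup>2 - 1) (scale a (K (K u)) + scale (inverse a) u)"
    by (simp add: th K_U[OF i] K_simps algebra_simps)
qed

text \<open>As for \<open>K_A\<close>, but the remainder lies one step lower, where \<open>K\<close>
  acts as \<open>q\<^sup>2 * x i\<close>; for \<open>i = 0\<close> it is zero.\<close>

lemma As_K:
  "scale (q\<^sup>2) (As (K v)) = K (As v) + scale (q\<^sup>2 - 1) (scale b (K (K v)) + scale (inverse b) v)"
proof (rule endo_eq_on_span_UNIV[where f="\<lambda>v. scale (q\<^sup>2) (As (K v))"
      and g="\<lambda>v. K (As v) + scale (q\<^sup>2 - 1) (scale b (K (K v)) + scale (inverse b) v)",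
      OF _ _ _ span_Union_U])
  show "endo (\<lambda>v. scale (q\<^sup>2) (As (K v)))"
    and "endo (\<lambda>v. K (As v) + scale (q\<^sup>2 - 1) (scale b (K (K v)) + scale (inverse b) v))"
    by (rule endoI; simp add: K_simps scale_right_distrib algebra_simps)+
  fix u assume "u \<in> (\<Union>i\<le>d. U i)"
  then obtain i where i: "i \<le> d" "u \<in> U i" by blast
  define r where "r = As u - scale (ths i) u"
  have Asu: "As u = scale (ths i) u + r" by (simp add: r_def)
  have Kr: "K r = scale (q\<^sup>2 * x i) r"
  proof (cases i)
    case 0
    then show ?thesis using i by (simp add: r_def U_As_0 K_simps)
  next
    case (Suc k)
    then have "r \<in> U k" unfolding r_def using i by (simp add: U_As)
    then show ?thesis using Suc i by (simp add: K_U x_Suc)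
  qed
  have ths: "ths i * x i = b * (x i * x i) + inverse b"
    using i x_nonzero[of i] by (simp add: ths_x field_simps)
  have "scale (q\<^sup>2) (As (K u)) = scale (q\<^sup>2 * (ths i * x i)) u + scale (q\<^sup>2 * x i) r"
    by (simp add: Asu K_U[OF i] scale_right_distrib mult_ac)
  also have "\<dots> = K (As u) + scale (q\<^sup>2 - 1) (scale (ths i * x i) u)"
    by (simp add: K_U[OF i] Asu K_simps Kr algebra_simps)
  finally show "scale (q\<^sup>2) (As (K u))
      = K (As u) + scale (q\<^sup>2 - 1) (scale b (K (K u)) + scale (inverse b) u)"
    by (simp add: ths K_U[OF i] K_simps algebra_simps)
qed

text \<open>Replacing \<open>i\<close> by \<open>d - i\<close> exchanges the two powers of
  \<open>q\<close> in \<open>th i\<close>, which amounts to inverting \<open>a\<close>.\<close>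

lemma td_racah_reverse:
  "td_racah scale d A As (\<lambda>i. E (d - i)) Es (\<lambda>i. th (d - i)) ths q (inverse a) b"
proof (intro td_racah.intro td_data_reverse td_racah_axioms.intro)
  fix i assume "i \<le> d"
  then show "th (d - i) = inverse a * q powi (int d - 2 * int i)
      + inverse (inverse a) * q powi (2 * int i - int d)"
    by (simp add: th of_nat_diff algebra_simps)
next
  show "inj_on (\<lambda>i. th (d - i)) {..d}"
  proof (rule inj_onI)
    fix i j assume "i \<in> {..d}" "j \<in> {..d}" "th (d - i) = th (d - j)"
    then show "i = j" using inj_onD[OF inj_th, of "d - i" "d - j"] by auto
  qed
qed (use q a b d ths in simp_all)

section \<open>Nondegeneracy of \<open>q\<close> and \<open>a\<close>\<close>

lemma x_0: "x 0 = q ^ (2 * n) * x n"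
proof (induction n)
  case (Suc n)
  then show ?case by (simp add: x_Suc[of n, symmetric] power2_eq_square mult_ac)
qed simp

text \<open>Equality would give \<open>x n = x 0\<close>, hence equal eigenvalues
  \<open>th n\<close> and \<open>th 0\<close>.\<close>

lemma q_power_neq_1: "1 \<le> n \<Longrightarrow> n \<le> d \<Longrightarrow> q ^ (2 * n) \<noteq> 1"
proof
  assume n: "1 \<le> n" "n \<le> d" "q ^ (2 * n) = 1"
  then have "x n = x 0" using x_0[of n] by simp
  then have "th n = th 0" using n by (simp add: th_x)
  then show False using inj_onD[OF inj_th, of n 0] n by simp
qed

lemma q2_neq_1: "q\<^sup>2 \<noteq> 1"
  using q_power_neq_1[of 1] d by (simp add: power2_eq_square)

lemma q_diff_nonzero: "q - inverse q \<noteq> 0"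
  using q q2_neq_1 by (simp add: field_simps power2_eq_square)

lemma q_int_nonzero:
  assumes "1 \<le> n" "n \<le> d"
  shows "q_int q n \<noteq> 0"
proof -
  have "q ^ n * (q ^ n - inverse q ^ n) = q ^ (2 * n) - 1"
    using q by (simp add: right_diff_distrib mult_2 power_add flip: power_mult_distrib)
  then show ?thesis
    using q_power_neq_1[OF assms] q_diff_nonzero by (auto simp: q_int_def)
qed

text \<open>If \<open>a\<close> were its own inverse, \<open>x d = inverse (x 0)\<close> would give
  \<open>th d = th 0\<close> although \<open>d\<close> is positive.\<close>

lemma a_diff_nonzero: "a - inverse a \<noteq> 0"
proof
  assume "a - inverse a = 0"
  then have a: "inverse a = a" by simp
  have "x d = inverse (x 0)" using inverse_x[of 0] by (simp add: x_def)
  then have "th d = th 0" by (simp add: th_x a algebra_simps)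
  then show False using inj_onD[OF inj_th, of d 0] d by simp
qed

lemma a2_neq_1: "a\<^sup>2 \<noteq> 1"
  using a a_diff_nonzero by (simp add: field_simps power2_eq_square)

section \<open>The operator \<open>B\<close> and the vanishing of the defect\<close>

definition B :: "'v \<Rightarrow> 'v" where "B = split_operator scale d q (split_decomp_down d E Es)"

lemma B_eq: "B = td_racah.K scale d (\<lambda>i. E (d - i)) Es q"
  unfolding B_def td_racah.K_def[OF td_racah_reverse]
  by (rule split_operator_cong) (rule split_decomp_down_eq)

lemma endo_B: "endo B"
  unfolding B_eq by (rule td_racah.endo_K[OF td_racah_reverse])

lemmas B_simps = endo_simps[OF endo_B]

text \<open>\<open>H\<close> is built from \<open>Es\<close> alone, so the reversed system has the
  same flag, and \<open>B\<close> has the same diagonal as \<open>K\<close>.\<close>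

lemma B_H: "i \<le> d \<Longrightarrow> v \<in> H (Suc i) \<Longrightarrow> B v - scale (x i) v \<in> H i"
  unfolding B_eq by (rule td_racah.K_H[OF td_racah_reverse])

lemma B_A:
  "scale (q\<^sup>2) (B (A v)) = A (B v) + scale (q\<^sup>2 - 1) (scale (inverse a) (B (B v)) + scale a v)"
  using td_racah.K_A[OF td_racah_reverse, of v] by (simp add: B_eq)

lemma As_B:
  "scale (q\<^sup>2) (As (B v)) = B (As v) + scale (q\<^sup>2 - 1) (scale b (B (B v)) + scale (inverse b) v)"
  unfolding B_eq by (rule td_racah.As_K[OF td_racah_reverse])

lemma q_defect_K_B: "q_defect (q\<^sup>2) (a\<^sup>2) K B v = 0"
proof -
  \<comment> \<open>Rescaling \<open>A\<close> and \<open>A\<^sup>*\<close> makes the coefficients of their relations polynomial in \<open>a\<close>, \<open>b\<close>, \<open>q\<close>.\<close>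
  define k where "k = a / (q\<^sup>2 - 1)"
  define l where "l = b / (q\<^sup>2 - 1)"
  have k: "k * (q\<^sup>2 - 1) = a" "k \<noteq> 0" and l: "l * (q\<^sup>2 - 1) = b" "l \<noteq> 0"
    using q2_neq_1 a b by (simp_all add: k_def l_def)
  obtain w where w: "Es 0 w \<noteq> 0" using Es_0_nonzero by blast
  have wH: "Es 0 w \<in> H (Suc 0)" by (simp add: H_def Es_Es)
  \<comment> \<open>\<open>k\<close> and \<open>l\<close> are nonzero, so the rescaled pair has the
    same invariant subspaces.\<close>
  have sub: "W = {0} \<or> W = UNIV"
    if W: "subspace W" "(\<lambda>v. scale k (A v)) ` W \<subseteq> W" "(\<lambda>v. scale l (As v)) ` W \<subseteq> W" for W
  proof (rule irreducible[OF W(1)])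
    have "A v \<in> W" if "v \<in> W" for v
      using W(2) that subspace_scale[OF W(1), of "scale k (A v)" "inverse k"] k by auto
    then show "A ` W \<subseteq> W" by blast
    have "As v \<in> W" if "v \<in> W" for v
      using W(3) that subspace_scale[OF W(1), of "scale l (As v)" "inverse l"] l by auto
    then show "As ` W \<subseteq> W" by blast
  qed
  show ?thesis
  proof (rule q_defect_eq_0[OF endo_K endo_B endo_scaled[OF A, of k] endo_scaled[OF As, of l],
        where e = "b\<^sup>2" and t = "x 0"])
    fix v
    have "scale (q\<^sup>2) (K (scale k (A v))) = scale k (scale (q\<^sup>2) (K (A v)))"
      by (simp add: K_simps mult.commute)
    also have "\<dots> = scale k (A (K v)) + scale a (scale a (K (K v)) + scale (inverse a) v)"
      unfolding K_A by (simp only: scale_right_distrib[of k] scale_scale k)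
    finally show "scale (q\<^sup>2) (K (scale k (A v)))
        = scale k (A (K v)) + scale (a\<^sup>2) (K (K v)) + scale 1 v"
      using a by (simp add: scale_right_distrib power2_eq_square)
    have "scale (q\<^sup>2) (B (scale k (A v))) = scale k (scale (q\<^sup>2) (B (A v)))"
      by (simp add: B_simps mult.commute)
    also have "\<dots> = scale k (A (B v)) + scale a (scale (inverse a) (B (B v)) + scale a v)"
      unfolding B_A by (simp only: scale_right_distrib[of k] scale_scale k)
    finally show "scale (q\<^sup>2) (B (scale k (A v)))
        = scale k (A (B v)) + scale 1 (B (B v)) + scale (a\<^sup>2) v"
      using a by (simp add: scale_right_distrib power2_eq_square)
    have "scale (q\<^sup>2) (scale l (As (K v))) = scale l (scale (q\<^sup>2) (As (K v)))"
      by (simp add: mult.commute)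
    also have "\<dots> = K (scale l (As v)) + scale b (scale b (K (K v)) + scale (inverse b) v)"
      unfolding As_K by (simp only: scale_right_distrib[of l] scale_scale l K_simps(3))
    finally show "scale (q\<^sup>2) (scale l (As (K v)))
        = K (scale l (As v)) + scale (b\<^sup>2) (K (K v)) + scale 1 v"
      using b by (simp add: scale_right_distrib power2_eq_square)
    have "scale (q\<^sup>2) (scale l (As (B v))) = scale l (scale (q\<^sup>2) (As (B v)))"
      by (simp add: mult.commute)
    also have "\<dots> = B (scale l (As v)) + scale b (scale b (B (B v)) + scale (inverse b) v)"
      unfolding As_B by (simp only: scale_right_distrib[of l] scale_scale l B_simps(3))
    finally show "scale (q\<^sup>2) (scale l (As (B v)))
        = B (scale l (As v)) + scale (b\<^sup>2) (B (B v)) + scale 1 v"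
      using b by (simp add: scale_right_distrib power2_eq_square)
  next
    \<comment> \<open>On \<open>H (Suc 0)\<close> the triangularity error of either operator lies in
      \<open>H 0\<close>, which is zero.\<close>
    show "K (Es 0 w) = scale (x 0) (Es 0 w)" "B (Es 0 w) = scale (x 0) (Es 0 w)"
      using K_H[OF _ wH] B_H[OF _ wH] by (simp_all add: H_0)
  qed (use w q a2_neq_1 sub in auto)
qed

section \<open>The operators \<open>M\<close> and \<open>\<psi>\<close>\<close>

definition M :: "'v \<Rightarrow> 'v" where "M = M_op scale a K B"

definition \<psi> :: "'v \<Rightarrow> 'v" where "\<psi> = psi_op scale q a K B"

lemma M_eq: "M v = scale (inverse (a - inverse a)) (scale a (K v) - scale (inverse a) (B v))"
  by (simp add: M_def M_op_def)

lemma endo_M: "endo M"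
  by (rule endoI) (simp_all add: M_eq K_simps B_simps algebra_simps)

lemmas M_simps = endo_simps[OF endo_M]

text \<open>\<open>M\<close> is a multiple of \<open>a\<^sup>2 K - B\<close>, so the two sides
  differ by a multiple of the defect.\<close>

lemma M_K_diff_B: "M (K v - B v) = scale (q\<^sup>2) (K (M v) - B (M v))"
proof -
  define m where "m = inverse (a - inverse a) * inverse a"
  have M: "M v = scale m (scale (a\<^sup>2) (K v) - B v)" for v
    using a by (simp add: M_eq m_def scale_right_diff_distrib power2_eq_square)
  have "scale (q\<^sup>2) (K (M v) - B (M v)) - M (K v - B v) = scale m (q_defect (q\<^sup>2) (a\<^sup>2) K B v)"
    by (simp add: M q_defect_def K_simps B_simps algebra_simps)
  then show ?thesis by (simp add: q_defect_K_B)
qed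

text \<open>\<open>M\<close> combines \<open>K\<close> and \<open>B\<close> with weights of sum 1,
  so it inherits their common diagonal \<open>x\<close>.\<close>

lemma M_H:
  assumes "i \<le> d" "v \<in> H (Suc i)"
  shows "M v - scale (x i) v \<in> H i"
proof -
  define m where "m = inverse (a - inverse a)"
  have m: "m * (a - inverse a) = 1" using a_diff_nonzero by (simp add: m_def)
  have "M v - scale (m * (a - inverse a) * x i) v
      = scale (m * a) (K v - scale (x i) v) - scale (m * inverse a) (B v - scale (x i) v)"
    unfolding M_eq m_def[symmetric] by (simp add: algebra_simps)
  then have "M v - scale (x i) v
      = scale (m * a) (K v - scale (x i) v) - scale (m * inverse a) (B v - scale (x i) v)"
    unfolding m by simp
  also have "\<dots> \<in> H i"
    using assms by (intro subspace_diff[OF subspace_H] subspace_scale[OF subspace_H] K_H B_H)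
  finally show ?thesis .
qed

lemma bij_M: "bij M"
  by (rule triangular_bij[OF endo_M M_H x_nonzero])

text \<open>The map \<open>?D\<close> inverted in \<open>psi_op\<close> takes \<open>K v\<close> to
  \<open>scale ?n (M v)\<close>. Inverting it at \<open>M v\<close> thus returns a multiple of
  \<open>K v\<close>, which the other factor turns into the same multiple of
  \<open>K v - B v\<close>.\<close>

lemma psi_M: "\<psi> (M v) = scale (inverse (q * (a - inverse a))) (K v - B v)"
proof -
  let ?D = "\<lambda>v. scale q (scale a v - scale (inverse a) (B (inv K v)))"
  let ?n = "q * (a - inverse a)"
  have K: "bij K" by (rule triangular_bij[OF endo_K K_H x_nonzero])
  have inv_K: "inv K (K v) = v" for v using K by (simp add: bij_is_inj)
  have D_K: "?D (K v) = scale ?n (M v)" for v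
    using a_diff_nonzero by (simp add: inv_K M_eq)
  have n: "?n \<noteq> 0" using q a_diff_nonzero by simp
  \<comment> \<open>\<open>inv\<close> selects some preimage, so its value at \<open>M v\<close> is
    pinned down only by injectivity.\<close>
  have "inj ?D"
  proof (rule injI)
    fix v w assume eq: "?D v = ?D w"
    obtain v' w' where "v = K v'" "w = K w'" using K by (meson bij_pointE)
    with eq D_K have "scale ?n (M v') = scale ?n (M w')" by simp
    then have "M v' = M w'" using n by simp
    then show "v = w" using bij_M \<open>v = K v'\<close> \<open>w = K w'\<close> by (auto simp: bij_def inj_def)
  qed
  moreover have "M v = ?D (K (scale (inverse ?n) v))"
    unfolding D_K M_simps(3) scale_scale right_inverse[OF n] by simp
  ultimately have "inv ?D (M v) = K (scale (inverse ?n) v)"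
    by (metis (no_types, lifting) inv_f_f)
  then have "\<psi> (M v) = K (scale (inverse ?n) v) - B (scale (inverse ?n) v)"
    by (simp only: \<psi>_def psi_op_def o_apply inv_K)
  then show ?thesis by (simp only: K_simps B_simps scale_right_diff_distrib)
qed

text \<open>Every vector is a value of \<open>M\<close>, so linearity can be read off from
  \<open>psi_M\<close>.\<close>

lemma endo_psi: "endo \<psi>"
proof (rule endoI)
  fix v w c
  obtain v' w' where [simp]: "v = M v'" "w = M w'" using bij_M by (meson bij_pointE)
  have "\<psi> (M (v' + w')) = \<psi> (M v') + \<psi> (M w')"
    by (simp add: psi_M K_simps B_simps scale_right_distrib scale_right_diff_distrib)
  then show "\<psi> (v + w) = \<psi> v + \<psi> w" by (simp add: M_simps)
  have "\<psi> (M (scale c v')) = scale c (\<psi> (M v'))"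
    by (simp add: psi_M K_simps B_simps scale_right_diff_distrib mult.commute)
  then show "\<psi> (scale c v) = scale c (\<psi> v)" by (simp add: M_simps)
qed

lemma M_psi: "M (\<psi> v) = scale (q\<^sup>2) (\<psi> (M v))"
proof -
  obtain w where "v = M w" using bij_M by (meson bij_pointE)
  let ?m = "inverse (q * (a - inverse a))"
  have "M (\<psi> (M w)) = scale ?m (scale (q\<^sup>2) (K (M w) - B (M w)))"
    by (simp only: psi_M M_simps(3) M_K_diff_B)
  also have "\<dots> = scale (q\<^sup>2) (\<psi> (M (M w)))"
    by (simp only: psi_M scale_left_commute)
  finally show ?thesis using \<open>v = M w\<close> by simp
qed

text \<open>\<open>K\<close> and \<open>B\<close> share their diagonal, so \<open>K - B\<close>
  lowers the flag; the preimage of \<open>v\<close> under \<open>M\<close> can be taken in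
  \<open>H (Suc i)\<close>.\<close>

lemma psi_H:
  assumes "i \<le> d" "v \<in> H (Suc i)"
  shows "\<psi> v \<in> H i"
proof -
  obtain w where w: "w \<in> H (Suc i)" "M w = v"
    using triangular_surj[OF endo_M M_H x_nonzero, of "Suc i" v] assms by auto
  have "K w - B w = (K w - scale (x i) w) - (B w - scale (x i) w)" by simp
  also have "\<dots> \<in> H i"
    using assms(1) w(1) by (intro subspace_diff[OF subspace_H] K_H B_H)
  finally show ?thesis
    using w(2) psi_M[of w] by (simp add: subspace_scale[OF subspace_H])
qed

text \<open>Each application lowers the flag by one step, and \<open>H (Suc d)\<close>, the whole
  space, is \<open>Suc d\<close> steps above \<open>H 0 = {0}\<close>.\<close>

lemma psi_nilpotent: "(\<lambda>v. scale c (\<psi> v)) ^^ Suc d = (\<lambda>_. 0)"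
proof
  fix v
  have "((\<lambda>v. scale c (\<psi> v)) ^^ n) v \<in> H (Suc d - n)" if "n \<le> Suc d" for n
    using that
  proof (induction n)
    case 0
    then show ?case by (simp add: H_Suc_d)
  next
    case (Suc n)
    then show ?case
      using psi_H[of "d - n"] by (auto simp: Suc_diff_le intro: subspace_scale[OF subspace_H])
  qed
  from this[of "Suc d"] show "((\<lambda>v. scale c (\<psi> v)) ^^ Suc d) v = 0"
    by (simp add: H_0 del: funpow.simps)
qed

text \<open>\<open>psi_M\<close> and \<open>M_eq\<close> are two linear equations in
  \<open>K v\<close> and \<open>B v\<close>; these are their solutions.\<close>

lemma K_psi: "K v = M v - scale (q * inverse a) (\<psi> (M v))"
  and B_psi: "B v = M v - scale (q * a) (\<psi> (M v))"
proof -
  define m where "m = inverse (a - inverse a)"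
  have m: "m * (a - inverse a) = 1" using a_diff_nonzero by (simp add: m_def)
  have psi_M': "scale (q * t) (\<psi> (M v)) = scale (t * m) (K v - B v)" for t
    using q by (simp add: psi_M m_def mult_ac)
  have "M v - scale (q * inverse a) (\<psi> (M v)) = scale (m * (a - inverse a)) (K v)"
    unfolding psi_M' unfolding M_eq m_def[symmetric] by (simp add: algebra_simps)
  then show "K v = M v - scale (q * inverse a) (\<psi> (M v))" by (simp add: m)
  have "M v - scale (q * a) (\<psi> (M v)) = scale (m * (a - inverse a)) (B v)"
    unfolding psi_M' unfolding M_eq m_def[symmetric] by (simp add: algebra_simps)
  then show "B v = M v - scale (q * a) (\<psi> (M v))" by (simp add: m)
qed

text \<open>Serves both identities: \<open>t\<close> is \<open>inverse a\<close> for
  \<open>K\<close> and \<open>a\<close> for \<open>B\<close>. The scalar in \<open>T\<close> makes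
  \<open>(q\<^sup>2 - 1) T\<close> equal to \<open>q t \<psi>\<close>.\<close>

lemma intertwining:
  assumes C: "endo C" "\<And>v. C v = M v - scale (q * t) (\<psi> (M v))"
  defines "T \<equiv> \<lambda>v. scale (t / (q - inverse q)) (\<psi> v)"
  shows "C \<circ> q_exp scale q T = q_exp scale q T \<circ> M"
proof (rule q_exp_intertwines[where d = d])
  show "endo T" unfolding T_def by (rule endo_scaled[OF endo_psi])
  show "T ^^ Suc d = (\<lambda>_. 0)" unfolding T_def by (rule psi_nilpotent)
  show "C v = M v - scale (q\<^sup>2 - 1) (T (M v))" for v
  proof -
    have "(q\<^sup>2 - 1) * (t / (q - inverse q)) = q * t"
      using q q_diff_nonzero by (simp add: field_simps power2_eq_square)
    then show ?thesis by (simp add: C T_def)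
  qed
  show "M (T v) = scale (q\<^sup>2) (T (M v))" for v
    by (simp add: T_def M_simps M_psi mult.commute)
qed (use C q q_int_nonzero in auto)

end

section \<open>Tridiagonal systems in terms of idempotents\<close>

text \<open>Applied once to \<open>A\<close> and once to \<open>As\<close>. Orthogonality comes from
  the ordering having no repetitions, completeness from diagonalizability.\<close>

lemma (in endomorphisms) standard_idempotents:
  assumes X: "endo X" "diagonalizable scale X"
    and idem: "\<And>i. i \<le> d \<Longrightarrow> primitive_idempotent scale X (range (P i)) (P i)"
    and std: "standard_ordering scale X Y d (\<lambda>i. range (P i))"
    and t: "\<And>i. i \<le> d \<Longrightarrow> range (P i) = eigenspace scale X (t i)"
  shows "\<And>i. i \<le> d \<Longrightarrow> endo (P i)"
    and "\<And>i j v. i \<le> d \<Longrightarrow> j \<le> d \<Longrightarrow> P i (P j v) = (if i = j then P j v else 0)"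
    and "\<And>v. (\<Sum>i\<le>d. P i v) = v"
    and "\<And>i v. i \<le> d \<Longrightarrow> P i (X v) = scale (t i) (P i v)"
    and "\<And>i j v. i \<le> d \<Longrightarrow> j \<le> d \<Longrightarrow> Suc j < i \<or> Suc i < j \<Longrightarrow> P j (Y (P i v)) = 0"
    and "\<And>i. i \<le> d \<Longrightarrow> \<exists>v. P i v \<noteq> 0"
    and "inj_on t {..d}"
proof -
  have endo: "endo (P i)" if "i \<le> d" for i
    using idem[OF that] by (simp add: primitive_idempotent_def)
  have bij: "bij_betw (\<lambda>i. range (P i)) {..d} (eigenspaces scale X)"
    using std by (simp add: standard_ordering_def atLeast0AtMost)
  then have inj: "inj_on (\<lambda>i. range (P i)) {..d}" by (rule bij_betw_imp_inj_on)
  have PP: "P i (P j v) = (if i = j then P j v else 0)" if "i \<le> d" "j \<le> d" for i j v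
  proof (cases "i = j")
    case True
    then show ?thesis using idem[OF \<open>i \<le> d\<close>] by (simp add: primitive_idempotent_def)
  next
    case False
    then have "range (P j) \<noteq> range (P i)" using inj_onD[OF inj, of j i] that by auto
    moreover have "range (P j) \<in> eigenspaces scale X"
      using idem[OF \<open>j \<le> d\<close>] by (simp add: primitive_idempotent_def)
    ultimately have "P i (P j v) = 0"
      using idem[OF \<open>i \<le> d\<close>] unfolding primitive_idempotent_def by blast
    then show ?thesis using False by simp
  qed
  have sum_P: "(\<Sum>i\<le>d. P i v) = v" for v
  proof (rule endo_eq_on_span_UNIV[where f="\<lambda>v. \<Sum>i\<le>d. P i v" and g="\<lambda>v. v"
        and S="\<Union>(eigenspaces scale X)"])
    show "endo (\<lambda>v. \<Sum>i\<le>d. P i v)"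
      by (rule endoI) (simp_all add: endo_simps[OF endo] sum.distrib scale_sum_right)
    show "endo (\<lambda>v. v)" by (rule endoI) simp_all
    show "span (\<Union>(eigenspaces scale X)) = UNIV"
      using X(2) by (simp add: diagonalizable_def)
    fix w assume "w \<in> \<Union>(eigenspaces scale X)"
    then have "w \<in> \<Union>((\<lambda>i. range (P i)) ` {..d})"
      using bij by (simp only: bij_betw_imp_surj_on)
    then obtain j u where j: "j \<le> d" "w = P j u" by blast
    then have "(\<Sum>i\<le>d. P i w) = (\<Sum>i\<le>d. if i = j then P j u else 0)"
      by (intro sum.cong) (auto simp: PP)
    also have "\<dots> = w" using j by simp
    finally show "(\<Sum>i\<le>d. P i w) = w" .
  qed
  have XP: "X (P i v) = scale (t i) (P i v)" if "i \<le> d" for i v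
    using t[OF that] unfolding eigenspace_def by blast
  have PX: "P i (X v) = scale (t i) (P i v)" if "i \<le> d" for i v
  proof -
    have "P i (X v) = P i (X (\<Sum>j\<le>d. P j v))" by (simp add: sum_P)
    also have "\<dots> = (\<Sum>j\<le>d. scale (t j) (P i (P j v)))"
      using that by (simp add: endo_simps[OF X(1)] endo_simps[OF endo] XP)
    also have "\<dots> = (\<Sum>j\<le>d. if j = i then scale (t i) (P i v) else 0)"
      using that by (intro sum.cong) (auto simp: PP)
    also have "\<dots> = scale (t i) (P i v)" using that by simp
    finally show ?thesis .
  qed
  have tri: "P j (Y (P i v)) = 0" if "i \<le> d" "j \<le> d" "Suc j < i \<or> Suc i < j" for i j v
  proof -
    \<comment> \<open>\<open>c\<close> marks an end of the chain, where the missing neighbour is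
      replaced by \<open>{0}\<close>.\<close>
    have 0: "P j u = 0" if "u \<in> (if c then {0} else range (P k))" "c \<or> k \<le> d" "j \<noteq> k" for u c k
      using that PP[of j k] \<open>j \<le> d\<close> by (auto simp: endo_simps[OF endo] split: if_splits)
    have "Y (P i v) \<in> (if i = 0 then {0} else range (P (i - 1))) + range (P i)
        + (if i = d then {0} else range (P (i + 1)))"
      using std \<open>i \<le> d\<close> unfolding standard_ordering_def by blast
    then obtain u1 u2 u3 where u: "Y (P i v) = u1 + u2 + u3"
        "u1 \<in> (if i = 0 then {0} else range (P (i - 1)))" "u2 \<in> range (P i)"
        "u3 \<in> (if i = d then {0} else range (P (i + 1)))"
      by (auto elim!: set_plus_elim)
    have "P j u1 = 0" by (rule 0[OF u(2)]) (use that in arith)+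
    moreover have "P j u2 = 0" by (rule 0[of u2 False i]) (use u(3) that in auto)
    moreover have "P j u3 = 0" by (rule 0[OF u(4)]) (use that in arith)+
    ultimately show ?thesis using that by (simp add: u(1) endo_simps[OF endo])
  qed
  have nonzero: "\<exists>v. P i v \<noteq> 0" if "i \<le> d" for i
  proof -
    have "range (P i) \<noteq> {0}"
      using idem[OF that] by (simp add: primitive_idempotent_def eigenspaces_def)
    then show ?thesis by auto
  qed
  show "inj_on t {..d}"
    using inj t unfolding inj_on_def by auto
  show "\<And>i. i \<le> d \<Longrightarrow> endo (P i)" by (fact endo)
  show "\<And>i j v. i \<le> d \<Longrightarrow> j \<le> d \<Longrightarrow> P i (P j v) = (if i = j then P j v else 0)" by (fact PP)
  show "\<And>v. (\<Sum>i\<le>d. P i v) = v" by (fact sum_P)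
  show "\<And>i v. i \<le> d \<Longrightarrow> P i (X v) = scale (t i) (P i v)" by (fact PX)
  show "\<And>i j v. i \<le> d \<Longrightarrow> j \<le> d \<Longrightarrow> Suc j < i \<or> Suc i < j \<Longrightarrow> P j (Y (P i v)) = 0" by (fact tri)
  show "\<And>i. i \<le> d \<Longrightarrow> \<exists>v. P i v \<noteq> 0" by (fact nonzero)
qed

lemma TD_system_td_data:
  fixes scale :: "'k::field \<Rightarrow> 'v::ab_group_add \<Rightarrow> 'v"
  assumes "vector_space scale" and TD: "TD_system scale d A E As Es"
    and th: "\<And>i. i \<le> d \<Longrightarrow> range (E i) = eigenspace scale A (th i)"
    and ths: "\<And>i. i \<le> d \<Longrightarrow> range (Es i) = eigenspace scale As (ths i)"
  shows "td_data scale d A As E Es th ths" and "inj_on th {..d}"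
proof -
  interpret endomorphisms scale
    using assms(1) by (simp add: endomorphisms_def)
  have A: "endo A" "endo As" and diag: "diagonalizable scale A" "diagonalizable scale As"
    using TD unfolding TD_system_def TD_pair_def by auto
  have irreducible: "W = {0} \<or> W = UNIV" if "subspace W" "A ` W \<subseteq> W" "As ` W \<subseteq> W" for W
    using TD that unfolding TD_system_def TD_pair_def by blast
  have idem: "\<And>i. i \<le> d \<Longrightarrow> primitive_idempotent scale A (range (E i)) (E i)"
    "\<And>i. i \<le> d \<Longrightarrow> primitive_idempotent scale As (range (Es i)) (Es i)"
    and std: "standard_ordering scale A As d (\<lambda>i. range (E i))"
    "standard_ordering scale As A d (\<lambda>i. range (Es i))"
    using TD unfolding TD_system_def by auto
  note E = standard_idempotents[OF A(1) diag(1) idem(1) std(1) th]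
    and Es = standard_idempotents[OF A(2) diag(2) idem(2) std(2) ths]
  show "inj_on th {..d}" by (rule E(7))
  show "td_data scale d A As E Es th ths"
  proof (intro td_data.intro endomorphisms_axioms td_data_axioms.intro)
    show "W = {0} \<or> W = UNIV" if "subspace W" "A ` W \<subseteq> W" "As ` W \<subseteq> W" for W
      using that by (rule irreducible)
  qed (simp_all add: A E(1-6) Es(1-6))
qed

theorem proposition7p1:
  fixes scale :: "'k::alg_closed_field \<Rightarrow> 'v::ab_group_add \<Rightarrow> 'v"
    and Basis :: "'v set"
    and d :: nat
    and A As :: "'v \<Rightarrow> 'v"
    and E Es :: "nat \<Rightarrow> 'v \<Rightarrow> 'v"
    and q a b :: 'k
    and K B \<psi> M :: "'v \<Rightarrow> 'v"
  assumes "finite_dimensional_vector_space scale Basis"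
    and "0 < vector_space.dim scale (UNIV :: 'v set)"
    and "1 \<le> d"
    and "TD_system scale d A E As Es"
    and "q_Racah_type scale d A E As Es q a b"
    and "K = K_op scale d E Es q"
    and "B = B_op scale d E Es q"
    and "\<psi> = psi_op scale q a K B"
    and "M = M_op scale a K B"
  shows "K \<circ> q_exp scale q (\<lambda>v. scale (inverse a / (q - inverse q)) (\<psi> v)) =
         q_exp scale q (\<lambda>v. scale (inverse a / (q - inverse q)) (\<psi> v)) \<circ> M \<and>
         B \<circ> q_exp scale q (\<lambda>v. scale (a / (q - inverse q)) (\<psi> v)) =
         q_exp scale q (\<lambda>v. scale (a / (q - inverse q)) (\<psi> v)) \<circ> M"
proof -
  define th where "th = (\<lambda>i. a * q powi (int d - 2 * int i) + inverse a * q powi (2 * int i - int d))"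
  define ths where "ths = (\<lambda>i. b * q powi (int d - 2 * int i) + inverse b * q powi (2 * int i - int d))"
  have V: "vector_space scale"
    using assms(1) by (simp add: finite_dimensional_vector_space_def)
  have racah: "q \<noteq> 0" "a \<noteq> 0" "b \<noteq> 0"
    "\<And>i. i \<le> d \<Longrightarrow> range (E i) = eigenspace scale A (th i)"
    "\<And>i. i \<le> d \<Longrightarrow> range (Es i) = eigenspace scale As (ths i)"
    using assms(5) by (auto simp: q_Racah_type_def th_def ths_def)
  interpret td: td_racah scale d A As E Es th ths q a b
    using TD_system_td_data[OF V assms(4) racah(4,5)] racah(1-3) assms(3)
    by (intro td_racah.intro td_racah_axioms.intro) (simp_all add: th_def ths_def)
  have "K = td.K" "B = td.B"
    by (simp_all add: assms(6,7) K_op_def B_op_def td.K_def td.B_def)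
  moreover have "\<psi> = td.\<psi>" "M = td.M"
    by (simp_all add: assms(8,9) calculation td.\<psi>_def td.M_def)
  ultimately show ?thesis
    using td.intertwining[OF td.endo_K td.K_psi] td.intertwining[OF td.endo_B td.B_psi] by simp
qed

end
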